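(* Let $L\ge1$, $\mathcal L=\llbracket 1,L\rrbracket$, and consider a discrete memoryless multiple access channel $(\mathcal X_{\mathcal L},q_{Z|X_{\mathcal L}},\mathcal Z)$ with $\mathcal X_l=\{0,1\}$ for all $l\in\mathcal L$, $\mathcal Z$ finite, and $X_{\mathcal L}=(X_l)_{l\in\mathcal L}$. Let $q_Z$ be a target distribution of the form $q_Z(z)=\sum_{x_{\mathcal L}}q_{Z|X_{\mathcal L}}(z|x_{\mathcal L})\prod_{l}q_{X_l}(x_l)$. Then the multiple access channel resolvability region satisfies $\mathcal R_{q_Z}=\mathcal R'_{q_Z}$, where $$\mathcal R'_{q_Z}\triangleq\bigcup_{p_T,(q_{X_l|T})_{l\in\mathcal L}}\{(R_l)_{l\in\mathcal L}: I(X_{\mathcal S};Z|T)\le R_{\mathcal S}\ \ \forall\mathcal S\subseteq\mathcal L\},$$ the union being over distributions $p_T$ on $\mathcal T=\llbracket 1,|\mathcal Z|+2^L-1\rrbracket$ and conditional distributions $(q_{X_l|T})_{l\in\mathcal L}$ such that for every $t\in\mathcal T$ and $z\in\mathcal Z$, $q_Z(z)=\sum_{x_{\mathcal L}}q_{Z|X_{\mathcal L}}(z|x_{\mathcal L})\prod_{l\in\mathcal L}q_{X_l|T}(x_l|t)$.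
   Context: $R_{\mathcal S}=\sum_{l\in\mathcal S}R_l$ and $X_{\mathcal S}=(X_l)_{l\in\mathcal S}$; information quantities are computed under $p_T(t)\prod_lq_{X_l|T}(x_l|t)q_{Z|X_{\mathcal L}}(z|x_{\mathcal L})$. A code with rates $(R_l)_{l\in\mathcal L}$ and blocklength $N$ consists of independent uniform randomization sequences $S_l\in\llbracket 1,2^{NR_l}\rrbracket$ and encoders $f_{l,N}:\llbracket1,2^{NR_l}\rrbracket\to\mathcal X_l^N$; Transmitter $l$ sends $f_{l,N}(S_l)$, inducing an output distribution $\widetilde p_{Z^{1:N}}$. A rate tuple is achievable if there is a sequence of such codes with $\lim_{N\to\infty}\mathbb V(\widetilde p_{Z^{1:N}},\prod_{i=1}^Nq_Z)=0$, where $\mathbb V(p,q)=\sum_x|p(x)-q(x)|$; $\mathcal R_{q_Z}$ is the closure of the set of achievable rate tuples. *)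

theory Defs
  imports "HOL-Analysis.Analysis"
begin

text \<open>Transmitters are indexed by a finite type 'l (so L = CARD('l) >= 1 automatically),
  the channel output alphabet is a finite type 'z, inputs are binary (bool).
  A channel is W x z = q_{Z|X_L}(z|x).  Logarithms are base 2 (rates in bits).\<close>

definition channel :: "(('l::finite \<Rightarrow> bool) \<Rightarrow> 'z::finite \<Rightarrow> real) \<Rightarrow> bool" where
  "channel W \<longleftrightarrow> (\<forall>x z. W x z \<ge> 0) \<and> (\<forall>x. (\<Sum>z\<in>UNIV. W x z) = 1)"

definition pmf_on :: "'a set \<Rightarrow> ('a \<Rightarrow> real) \<Rightarrow> bool" where
  "pmf_on A p \<longleftrightarrow> (\<forall>a\<in>A. p a \<ge> 0) \<and> (\<Sum>a\<in>A. p a) = 1"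

definition Tset :: "'l::finite itself \<Rightarrow> 'z::finite itself \<Rightarrow> nat set" where
  "Tset _ _ = {1 .. CARD('z) + 2 ^ CARD('l) - 1}"

definition out_dist ::
  "(('l::finite \<Rightarrow> bool) \<Rightarrow> 'z::finite \<Rightarrow> real) \<Rightarrow> ('l \<Rightarrow> bool \<Rightarrow> real) \<Rightarrow> 'z \<Rightarrow> real" where
  "out_dist W qX z = (\<Sum>x\<in>UNIV. W x z * (\<Prod>l\<in>UNIV. qX l (x l)))"

definition cond_MI ::
  "(('l::finite \<Rightarrow> bool) \<Rightarrow> 'z::finite \<Rightarrow> real) \<Rightarrow> nat set \<Rightarrow> (nat \<Rightarrow> real)
     \<Rightarrow> ('l \<Rightarrow> nat \<Rightarrow> bool \<Rightarrow> real) \<Rightarrow> 'l set \<Rightarrow> real" where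
  "cond_MI W TT pT qXT S =
    (let P = (\<lambda>t x z. pT t * (\<Prod>l\<in>UNIV. qXT l t (x l)) * W x z);
         PTXSZ = (\<lambda>t x z. \<Sum>x'\<in>{x'. \<forall>l\<in>S. x' l = x l}. P t x' z);
         PTXS = (\<lambda>t x. \<Sum>z\<in>UNIV. PTXSZ t x z);
         PTZ = (\<lambda>t z. \<Sum>x'\<in>UNIV. P t x' z);
         PT = (\<lambda>t. \<Sum>x'\<in>UNIV. \<Sum>z\<in>UNIV. P t x' z)
     in \<Sum>t\<in>TT. \<Sum>x\<in>UNIV. \<Sum>z\<in>UNIV.
          P t x z * log 2 ((PTXSZ t x z * PT t) / (PTXS t x * PTZ t z)))"

definition region' ::
  "(('l::finite \<Rightarrow> bool) \<Rightarrow> 'z::finite \<Rightarrow> real) \<Rightarrow> ('z \<Rightarrow> real) \<Rightarrow> (real ^ 'l) set" where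
  "region' W qZ =
    (\<Union>pT \<in> {pT. pmf_on (Tset TYPE('l) TYPE('z)) pT}.
      \<Union>qXT \<in> {qXT. (\<forall>l. \<forall>t\<in>Tset TYPE('l) TYPE('z). pmf_on UNIV (qXT l t)) \<and>
                   (\<forall>t\<in>Tset TYPE('l) TYPE('z). \<forall>z. qZ z = out_dist W (\<lambda>l. qXT l t) z)}.
        {R. \<forall>S. cond_MI W (Tset TYPE('l) TYPE('z)) pT qXT S \<le> (\<Sum>l\<in>S. R $ l)})"

text \<open>Number of randomization values of transmitter l: |[1, 2^{N R_l}]|.\<close>
definition msg_size :: "nat \<Rightarrow> real \<Rightarrow> nat" where
  "msg_size N r = nat \<lfloor>2 powr (real N * r)\<rfloor>"

text \<open>A code of blocklength N: f l s i is the i-th symbol (i < N) sent by transmitter l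
  for randomization value s.  Induced output distribution on sequences z (i < N).\<close>
definition induced_dist ::
  "(('l::finite \<Rightarrow> bool) \<Rightarrow> 'z::finite \<Rightarrow> real) \<Rightarrow> real ^ 'l \<Rightarrow> nat
     \<Rightarrow> ('l \<Rightarrow> nat \<Rightarrow> nat \<Rightarrow> bool) \<Rightarrow> (nat \<Rightarrow> 'z) \<Rightarrow> real" where
  "induced_dist W R N f zs =
     (\<Sum>s\<in>Pi\<^sub>E UNIV (\<lambda>l. {1 .. msg_size N (R $ l)}).
        (\<Prod>l\<in>UNIV. 1 / real (msg_size N (R $ l))) *
        (\<Prod>i<N. W (\<lambda>l. f l (s l) i) (zs i)))"

definition var_dist_N :: "nat \<Rightarrow> ((nat \<Rightarrow> 'z::finite) \<Rightarrow> real) \<Rightarrow> ((nat \<Rightarrow> 'z) \<Rightarrow> real) \<Rightarrow> real" where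
  "var_dist_N N p q = (\<Sum>zs\<in>Pi\<^sub>E {..<N} (\<lambda>_. UNIV). \<bar>p zs - q zs\<bar>)"

definition achievable ::
  "(('l::finite \<Rightarrow> bool) \<Rightarrow> 'z::finite \<Rightarrow> real) \<Rightarrow> ('z \<Rightarrow> real) \<Rightarrow> real ^ 'l \<Rightarrow> bool" where
  "achievable W qZ R \<longleftrightarrow>
     (\<exists>f :: nat \<Rightarrow> 'l \<Rightarrow> nat \<Rightarrow> nat \<Rightarrow> bool.
        (\<lambda>N. var_dist_N N (induced_dist W R N (f N)) (\<lambda>zs. \<Prod>i<N. qZ (zs i))) \<longlonglongrightarrow> 0)"

definition resolvability_region ::
  "(('l::finite \<Rightarrow> bool) \<Rightarrow> 'z::finite \<Rightarrow> real) \<Rightarrow> ('z \<Rightarrow> real) \<Rightarrow> (real ^ 'l) set" where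
  "resolvability_region W qZ = closure {R. achievable W qZ R}"

end

theory Submission
  imports Defs
begin

text \<open>
  For input biases \<open>a\<close> let \<open>info a\<close> be the vector of the mutual informations \<open>I(X\<^sub>S;Z)\<close>, \<open>S \<subseteq> L\<close>, with the
  output entropy frozen at that of \<open>qZ\<close>, and let \<open>C\<close> be the convex hull of \<open>info a\<close> over all \<open>a\<close> that
  induce \<open>qZ\<close>. By Caratheodory's theorem (the coordinate \<open>S = {}\<close> vanishes, which saves one point)
  the single-letter region is the set of all \<open>R\<close> for which some \<open>v \<in> C\<close> satisfies \<open>v $ S \<le> R\<^sub>S\<close> for
  every \<open>S\<close>; it is closed because \<open>C\<close> is compact.

  Achievability is random coding along a random time-sharing word: the expected squared Hellinger distance
  between the induced and the target distribution is at most a sum over \<open>S \<noteq> {}\<close> of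
  \<open>M\<^sub>S powr -\<rho> / \<rho>\<close> times the \<open>N\<close>-th power of a Renyi-type moment whose logarithmic derivative at \<open>\<rho> = 0\<close>
  is \<open>v $ S * ln 2\<close>, so it decays exponentially for small \<open>\<rho>\<close> as soon as \<open>v $ S < R\<^sub>S\<close>.

  Conversely, the output law given the codewords of the transmitters in \<open>S\<close> is at most \<open>M\<^sub>S\<close> times the output law; together
  with Gibbs' inequality and continuity of entropy this bounds the averages of \<open>info\<close> over the
  empirical letter biases by \<open>R\<^sub>S + o(1)\<close>. These biases induce output laws close to \<open>qZ\<close>, hence by
  compactness the averages are close to \<open>C\<close>.
\<close>

section \<open>Product expectations\<close>

text \<open>One functional serves input letters, words, message indices and whole codebooks, hence
  alphabet sets that may vary with the coordinate.\<close>

definition expect ::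
  "('l::finite \<Rightarrow> 'a set) \<Rightarrow> ('l \<Rightarrow> 'a \<Rightarrow> real) \<Rightarrow> (('l \<Rightarrow> 'a) \<Rightarrow> real) \<Rightarrow> real" where
  "expect A q F = (\<Sum>x\<in>Pi\<^sub>E UNIV A. (\<Prod>l\<in>UNIV. q l (x l)) * F x)"

definition mix :: "'l set \<Rightarrow> ('l \<Rightarrow> 'a) \<Rightarrow> ('l \<Rightarrow> 'a) \<Rightarrow> 'l \<Rightarrow> 'a" where
  "mix S x y = (\<lambda>l. if l \<in> S then x l else y l)"

definition pmfs :: "('l::finite \<Rightarrow> 'a set) \<Rightarrow> ('l \<Rightarrow> 'a \<Rightarrow> real) \<Rightarrow> bool" where
  "pmfs A q \<longleftrightarrow> (\<forall>l. finite (A l) \<and> pmf_on (A l) (q l))"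

lemma pmfs_finite: "pmfs A q \<Longrightarrow> finite (A l)"
  and pmfs_nonneg: "pmfs A q \<Longrightarrow> a \<in> A l \<Longrightarrow> 0 \<le> q l a"
  and pmfs_sum: "pmfs A q \<Longrightarrow> (\<Sum>a\<in>A l. q l a) = 1"
  by (auto simp: pmfs_def pmf_on_def)

lemma weight_nonneg: "pmfs A q \<Longrightarrow> x \<in> Pi\<^sub>E UNIV A \<Longrightarrow> 0 \<le> (\<Prod>l\<in>UNIV. q l (x l))"
  by (intro prod_nonneg pmfs_nonneg[of A q]) auto

lemma expect_add: "expect A q (\<lambda>x. F x + G x) = expect A q F + expect A q G"
  by (simp add: expect_def ring_distribs sum.distrib)

lemma expect_diff: "expect A q (\<lambda>x. F x - G x) = expect A q F - expect A q G"
  by (simp add: expect_def ring_distribs sum_subtractf)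

lemma expect_cmult: "expect A q (\<lambda>x. c * F x) = c * expect A q F"
  unfolding expect_def sum_distrib_left by (simp add: mult.left_commute)

lemma expect_multc: "expect A q (\<lambda>x. F x * c) = expect A q F * c"
  unfolding expect_def sum_distrib_right by (simp add: mult.assoc)

lemma expect_sum: "expect A q (\<lambda>x. \<Sum>i\<in>I. F i x) = (\<Sum>i\<in>I. expect A q (F i))"
  unfolding expect_def sum_distrib_left by (rule sum.swap)

lemma expect_swap:
  "expect A q (\<lambda>x. expect B r (F x)) = expect B r (\<lambda>y. expect A q (\<lambda>x. F x y))"
  unfolding expect_def sum_distrib_left by (subst sum.swap) (simp add: mult_ac)

lemma expect_mono:
  assumes "pmfs A q" "\<And>x. x \<in> Pi\<^sub>E UNIV A \<Longrightarrow> F x \<le> G x"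
  shows "expect A q F \<le> expect A q G"
  unfolding expect_def
  by (intro sum_mono mult_left_mono weight_nonneg[OF assms(1)] assms(2))

lemma expect_cong:
  "(\<And>x. x \<in> Pi\<^sub>E UNIV A \<Longrightarrow> F x = G x) \<Longrightarrow> expect A q F = expect A q G"
  by (simp add: expect_def)

lemma expect_const: "pmfs A q \<Longrightarrow> expect A q (\<lambda>_. c) = c"
proof -
  assume p: "pmfs A q"
  have "expect A q (\<lambda>_. 1) = (\<Prod>l\<in>UNIV. \<Sum>a\<in>A l. q l a)"
    unfolding expect_def by (subst prod_sum_PiE) (auto intro: pmfs_finite[OF p])
  then show ?thesis
    using expect_cmult[of A q c "\<lambda>_. 1"] by (simp add: pmfs_sum[OF p])
qed

lemma expect_nonneg:
  assumes "pmfs A q" "\<And>x. x \<in> Pi\<^sub>E UNIV A \<Longrightarrow> 0 \<le> F x"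
  shows "0 \<le> expect A q F"
  unfolding expect_def by (intro sum_nonneg mult_nonneg_nonneg weight_nonneg[OF assms(1)] assms(2))

lemma exists_le_weighted_mean:
  fixes w X :: "'t \<Rightarrow> real"
  assumes w: "\<And>t. t \<in> T \<Longrightarrow> 0 \<le> w t" "sum w T = 1" and le: "(\<Sum>t\<in>T. w t * X t) \<le> b"
  shows "\<exists>t\<in>T. X t \<le> b"
proof (rule ccontr)
  assume "\<not> ?thesis"
  then have gt: "\<And>t. t \<in> T \<Longrightarrow> b < X t" by auto
  \<comment> \<open>A sum over an infinite set is 0 by convention, so total weight 1 forces
    \<open>T\<close> to be finite.\<close>
  have fin: "finite T" using w(2) by (metis sum.infinite zero_neq_one)
  obtain t where t: "t \<in> T" "w t \<noteq> 0"
    using w(2) by (metis sum.neutral zero_neq_one)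
  with w(1)[OF t(1)] have pos: "0 < w t" by linarith
  have "(\<Sum>t\<in>T. w t * b) < (\<Sum>t\<in>T. w t * X t)"
  proof (rule sum_strict_mono_ex1[OF fin])
    show "\<forall>t\<in>T. w t * b \<le> w t * X t"
      by (intro ballI mult_left_mono less_imp_le[OF gt] w(1))
    show "\<exists>t\<in>T. w t * b < w t * X t"
      by (intro bexI[OF _ t(1)] mult_strict_left_mono gt[OF t(1)] pos)
  qed
  with w(2) le show False by (simp flip: sum_distrib_right)
qed

lemma expect_exists_le:
  assumes "pmfs A q" "expect A q F \<le> b"
  shows "\<exists>x\<in>Pi\<^sub>E UNIV A. F x \<le> b"
proof (rule exists_le_weighted_mean)
  show "(\<Sum>x\<in>Pi\<^sub>E UNIV A. (\<Prod>l\<in>UNIV. q l (x l))) = 1"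
    using expect_const[OF assms(1), of 1] by (simp add: expect_def)
  show "(\<Sum>x\<in>Pi\<^sub>E UNIV A. (\<Prod>l\<in>UNIV. q l (x l)) * F x) \<le> b"
    using assms(2) by (simp add: expect_def)
qed (rule weight_nonneg[OF assms(1)])

text \<open>Change of variables: group the tuples \<open>b\<close> by their image. A fibre of a
  coordinatewise map is a box, over which the product weight factorises.\<close>

lemma expect_push:
  assumes B: "\<And>l. finite (B l)" and A: "\<And>l. finite (A l)"
    and g: "\<And>l b. b \<in> B l \<Longrightarrow> g l b \<in> A l"
    and law: "\<And>l a. a \<in> A l \<Longrightarrow> (\<Sum>b\<in>{b \<in> B l. g l b = a}. r l b) = q l a"
  shows "expect B r (\<lambda>b. F (\<lambda>l. g l (b l))) = expect A q F"
proof -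
  have finA: "finite (Pi\<^sub>E UNIV A)" and finB: "finite (Pi\<^sub>E UNIV B)"
    by (intro finite_PiE; simp add: A B)+
  have "expect A q F =
      (\<Sum>x\<in>Pi\<^sub>E UNIV A. (\<Prod>l\<in>UNIV. \<Sum>b\<in>{b \<in> B l. g l b = x l}. r l b) * F x)"
    unfolding expect_def by (intro sum.cong refl) (auto simp: law PiE_def Pi_def)
  also have "\<dots> = (\<Sum>x\<in>Pi\<^sub>E UNIV A. (\<Sum>b\<in>Pi\<^sub>E UNIV (\<lambda>l. {b \<in> B l. g l b = x l}).
      \<Prod>l\<in>UNIV. r l (b l)) * F x)"
    by (subst prod_sum_PiE) (auto simp: B)
  also have "\<dots> = (\<Sum>x\<in>Pi\<^sub>E UNIV A. \<Sum>b\<in>{b \<in> Pi\<^sub>E UNIV B. (\<lambda>l. g l (b l)) = x}.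
      (\<Prod>l\<in>UNIV. r l (b l)) * F (\<lambda>l. g l (b l)))"
    unfolding sum_distrib_right
    by (intro sum.cong refl) (auto simp: PiE_def Pi_def fun_eq_iff)
  also have "\<dots> = expect B r (\<lambda>b. F (\<lambda>l. g l (b l)))"
    unfolding expect_def
    by (rule sum.group[OF finB finA]) (auto simp: PiE_def Pi_def g)
  finally show ?thesis by simp
qed

text \<open>Two independent tuples are read as one tuple of pairs, which brings double expectations
  within reach of \<open>expect_push\<close>.\<close>

lemma expect_pair:
  fixes A :: "'l::finite \<Rightarrow> 'a set"
  shows "expect A q (\<lambda>x. expect A q (\<lambda>y. F (\<lambda>l. (x l, y l)))) =
    expect (\<lambda>l. A l \<times> A l) (\<lambda>l p. q l (fst p) * q l (snd p)) F"
proof -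
  have "expect A q (\<lambda>x. expect A q (\<lambda>y. F (\<lambda>l. (x l, y l)))) =
    (\<Sum>(x, y)\<in>Pi\<^sub>E UNIV A \<times> Pi\<^sub>E UNIV A.
      (\<Prod>l\<in>UNIV. q l (x l) * q l (y l)) * F (\<lambda>l. (x l, y l)))"
    unfolding expect_def sum_distrib_left
    by (subst sum.cartesian_product) (simp add: prod.distrib mult_ac)
  also have "\<dots> = expect (\<lambda>l. A l \<times> A l) (\<lambda>l p. q l (fst p) * q l (snd p)) F"
    unfolding expect_def
    by (rule sum.reindex_bij_witness
        [where i = "\<lambda>p. (fst \<circ> p, snd \<circ> p)" and j = "\<lambda>(x, y) l. (x l, y l)"])
      (auto simp: PiE_def Pi_def fun_eq_iff mem_Times_iff)
  finally show ?thesis .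
qed

text \<open>Taking the coordinates outside \<open>S\<close> from an independent copy does not change
  a product law: the discarded half of each pair sums to 1.\<close>

lemma expect_mix:
  assumes "pmfs A q"
  shows "expect A q (\<lambda>x. expect A q (\<lambda>y. F (mix S x y))) = expect A q F"
proof -
  have fin: "finite (A l)" for l by (rule pmfs_finite[OF assms])
  have "expect A q (\<lambda>x. expect A q (\<lambda>y. F (mix S x y))) =
    expect (\<lambda>l. A l \<times> A l) (\<lambda>l p. q l (fst p) * q l (snd p))
      (\<lambda>p. F (\<lambda>l. if l \<in> S then fst (p l) else snd (p l)))"
    using expect_pair[of A q "\<lambda>p. F (\<lambda>l. if l \<in> S then fst (p l) else snd (p l))"]
    by (simp add: mix_def cong: if_cong)
  also have "\<dots> = expect A q F"
  proof (rule expect_push[where g = "\<lambda>l p. if l \<in> S then fst p else snd p"])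
    fix l a assume a: "a \<in> A l"
    show "(\<Sum>b\<in>{b \<in> A l \<times> A l. (if l \<in> S then fst b else snd b) = a}. q l (fst b) * q l (snd b)) = q l a"
    proof (cases "l \<in> S")
      case True
      have "{b \<in> A l \<times> A l. fst b = a} = {a} \<times> A l" using a by auto
      then show ?thesis using True pmfs_sum[OF assms, of l]
        by (simp add: sum.cartesian_product' flip: sum_distrib_left)
    next
      case False
      have "{b \<in> A l \<times> A l. snd b = a} = A l \<times> {a}" using a by auto
      then show ?thesis using False pmfs_sum[OF assms, of l]
        by (simp add: sum.cartesian_product' flip: sum_distrib_right)
    qed
  qed (auto simp: fin)
  finally show ?thesis .
qed

section \<open>Random codebooks\<close>

definition codebooks :: "('l \<Rightarrow> 'm set) \<Rightarrow> ('l \<Rightarrow> 'a set) \<Rightarrow> 'l \<Rightarrow> ('m \<Rightarrow> 'a) set" where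
  "codebooks I A = (\<lambda>l. Pi\<^sub>E (I l) (\<lambda>_. A l))"

definition codebook_law :: "('l \<Rightarrow> 'm set) \<Rightarrow> ('l \<Rightarrow> 'a \<Rightarrow> real) \<Rightarrow> 'l \<Rightarrow> ('m \<Rightarrow> 'a) \<Rightarrow> real" where
  "codebook_law I q = (\<lambda>l c. \<Prod>m\<in>I l. q l (c m))"

lemma pmfs_codebooks:
  assumes "pmfs A q" "\<And>l. finite (I l)"
  shows "pmfs (codebooks I A) (codebook_law I q)"
proof -
  have "(\<Sum>c\<in>Pi\<^sub>E (I l) (\<lambda>_. A l). \<Prod>m\<in>I l. q l (c m)) = 1" for l
    by (subst prod_sum_PiE[symmetric])
      (auto simp: pmfs_finite[OF assms(1)] pmfs_sum[OF assms(1)] assms(2))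
  then show ?thesis
    unfolding pmfs_def pmf_on_def codebooks_def codebook_law_def
    by (auto intro!: finite_PiE assms(2) pmfs_finite[OF assms(1)] prod_nonneg pmfs_nonneg[OF assms(1)])
qed

text \<open>Codewords are drawn independently, so the two transmitted tuples coincide in the
  coordinates where the messages agree and are independent elsewhere. Both sides reduce to the same
  law \<open>w\<close> on pairs.\<close>

lemma expect_codebook:
  fixes s s' :: "'l::finite \<Rightarrow> 'm"
  assumes p: "pmfs A q" and I: "\<And>l. finite (I l)" and s: "\<And>l. s l \<in> I l" "\<And>l. s' l \<in> I l"
  shows "expect (codebooks I A) (codebook_law I q) (\<lambda>c. F (\<lambda>l. c l (s l)) (\<lambda>l. c l (s' l))) =
    expect A q (\<lambda>x. expect A q (\<lambda>y. F x (mix {l. s l = s' l} x y)))"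
proof -
  define w where "w = (\<lambda>l (p::'a \<times> 'a). q l (fst p) *
    (if s l = s' l then of_bool (fst p = snd p) else q l (snd p)))"
  define G where "G = (\<lambda>p. F (\<lambda>l. fst (p l)) (\<lambda>l. snd (p l)))"
  have fin: "finite (A l)" for l by (rule pmfs_finite[OF p])
  have "expect (codebooks I A) (codebook_law I q) (\<lambda>c. F (\<lambda>l. c l (s l)) (\<lambda>l. c l (s' l))) =
    expect (codebooks I A) (codebook_law I q) (\<lambda>c. G (\<lambda>l. (c l (s l), c l (s' l))))"
    by (simp add: G_def)
  also have "\<dots> = expect (\<lambda>l. A l \<times> A l) w G"
  proof (rule expect_push[where g = "\<lambda>l c. (c (s l), c (s' l))"])
    fix l and p' assume "p' \<in> A l \<times> A l"
    then obtain a b where ab: "p' = (a, b)" "a \<in> A l" "b \<in> A l" by auto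
    show "(\<Sum>c\<in>{c \<in> codebooks I A l. (c (s l), c (s' l)) = p'}. codebook_law I q l c) = w l p'"
    proof (cases "s l = s' l \<and> a \<noteq> b")
      case True
      then have "{c \<in> codebooks I A l. (c (s l), c (s' l)) = p'} = {}" using ab by auto
      with True ab show ?thesis by (simp only:) (simp add: w_def)
    next
      case False
      \<comment> \<open>The fibre is a box with the entries at \<open>s l\<close> and
        \<open>s' l\<close> pinned; if these messages coincide, then \<open>a = b\<close> and one
        pin suffices.\<close>
      define Q where "Q = (\<lambda>m. if m = s l then {a} else if m = s' l then {b} else A l)"
      have Q: "{c \<in> codebooks I A l. (c (s l), c (s' l)) = p'} = Pi\<^sub>E (I l) Q"
      proof (intro set_eqI iffI)
        fix c assume "c \<in> {c \<in> codebooks I A l. (c (s l), c (s' l)) = p'}"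
        then have c: "c \<in> Pi\<^sub>E (I l) (\<lambda>_. A l)" "c (s l) = a" "c (s' l) = b"
          by (simp_all add: codebooks_def ab(1))
        have "c m \<in> Q m" if "m \<in> I l" for m
          using PiE_mem[OF c(1) that] c(2,3) by (simp add: Q_def)
        then show "c \<in> Pi\<^sub>E (I l) Q" using c(1) by (simp add: PiE_iff)
      next
        fix c assume c: "c \<in> Pi\<^sub>E (I l) Q"
        have "c (s l) = a" "c (s' l) = b"
          using PiE_mem[OF c s(1)] PiE_mem[OF c s(2)] False by (auto simp: Q_def split: if_splits)
        moreover have "c m \<in> A l" if "m \<in> I l" for m
          using PiE_mem[OF c that] ab(2,3) by (auto simp: Q_def split: if_splits)
        ultimately show "c \<in> {c \<in> codebooks I A l. (c (s l), c (s' l)) = p'}"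
          using c by (simp add: PiE_iff codebooks_def ab(1))
      qed
      have Qs: "(\<Sum>a\<in>Q m. q l a) = (if m = s l then q l a else if m = s' l then q l b else 1)" for m
        using pmfs_sum[OF p, of l] by (simp add: Q_def)
      have "(\<Sum>c\<in>Pi\<^sub>E (I l) Q. codebook_law I q l c) = (\<Prod>m\<in>I l. \<Sum>a\<in>Q m. q l a)"
        unfolding codebook_law_def by (subst prod_sum_PiE) (auto simp: I Q_def fin)
      also have "\<dots> = q l a * (\<Prod>m\<in>I l - {s l}. \<Sum>a\<in>Q m. q l a)"
        by (subst prod.remove[OF I s(1)]) (simp add: Qs)
      also have "(\<Prod>m\<in>I l - {s l}. \<Sum>a\<in>Q m. q l a) = (if s l = s' l then 1 else q l b)"
      proof (cases "s l = s' l")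
        case True
        then show ?thesis by (auto intro!: prod.neutral simp: Qs)
      next
        case False
        then have "(\<Prod>m\<in>I l - {s l}. \<Sum>a\<in>Q m. q l a) = (\<Prod>m\<in>I l - {s l}. if m = s' l then q l b else 1)"
          by (intro prod.cong) (auto simp: Qs)
        then show ?thesis using False s[of l] by (simp add: prod.delta I)
      qed
      finally show ?thesis using False ab Q by (auto simp: w_def)
    qed
  qed (auto simp: fin I s codebooks_def PiE_def Pi_def intro!: finite_PiE[unfolded PiE_def Pi_def])
  \<comment> \<open>The law \<open>w\<close> also arises from two independent letters when the first
    overwrites the second wherever the messages agree.\<close>
  also have "\<dots> = expect (\<lambda>l. A l \<times> A l) (\<lambda>l p. q l (fst p) * q l (snd p))
      (\<lambda>p. G (\<lambda>l. (fst (p l), if s l = s' l then fst (p l) else snd (p l))))"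
  proof (rule sym, rule expect_push[where g = "\<lambda>l p. (fst p, if s l = s' l then fst p else snd p)"])
    fix l and p' assume "p' \<in> A l \<times> A l"
    then obtain a b where ab: "p' = (a, b)" "a \<in> A l" "b \<in> A l" by auto
    show "(\<Sum>c\<in>{c \<in> A l \<times> A l. (fst c, if s l = s' l then fst c else snd c) = p'}.
        q l (fst c) * q l (snd c)) = w l p'"
    proof (cases "s l = s' l")
      case True
      have "{c \<in> A l \<times> A l. (fst c, fst c) = p'} = (if a = b then {a} \<times> A l else {})"
        using ab by auto
      then show ?thesis using True ab pmfs_sum[OF p, of l]
        by (simp add: w_def sum.cartesian_product' flip: sum_distrib_left)
    next
      case False
      have "{c \<in> A l \<times> A l. (fst c, snd c) = p'} = {(a, b)}"
        using ab by auto
      then show ?thesis using False ab by (simp add: w_def)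
    qed
  qed (auto simp: fin)
  also have "\<dots> = expect A q (\<lambda>x. expect A q (\<lambda>y. F x (mix {l. s l = s' l} x y)))"
    unfolding expect_pair[symmetric] G_def by (simp add: mix_def cong: if_cong)
  finally show ?thesis .
qed

lemma expect_codeword:
  fixes s :: "'l::finite \<Rightarrow> 'm"
  assumes p: "pmfs A q" and I: "\<And>l. finite (I l)" and s: "\<And>l. s l \<in> I l"
  shows "expect (codebooks I A) (codebook_law I q) (\<lambda>c. F (\<lambda>l. c l (s l))) = expect A q F"
  using expect_codebook[OF p I s s, where F = "\<lambda>x _. F x"] by (simp add: expect_const[OF p])

section \<open>Soft covering\<close>

text \<open>The output law given the inputs in \<open>S\<close>, the others being averaged out.
  Keeping the full tuple \<open>x\<close> as argument lets \<open>S\<close> vary without a change of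
  type.\<close>

definition marg ::
  "('l::finite \<Rightarrow> 'a set) \<Rightarrow> ('l \<Rightarrow> 'a \<Rightarrow> real) \<Rightarrow> (('l \<Rightarrow> 'a) \<Rightarrow> 'b \<Rightarrow> real) \<Rightarrow>
    'l set \<Rightarrow> ('l \<Rightarrow> 'a) \<Rightarrow> 'b \<Rightarrow> real" where
  "marg A q V S x z = expect A q (\<lambda>y. V (mix S x y) z)"

lemma mix_empty [simp]: "mix {} x y = y"
  by (simp add: mix_def)

lemma mix_mix [simp]: "mix S (mix S x y) y' = mix S x y'"
  by (auto simp: mix_def)

lemma marg_empty: "marg A q V {} x z = expect A q (\<lambda>x. V x z)"
  by (simp add: marg_def)

lemma marg_mix [simp]: "marg A q V S (mix S x y) z = marg A q V S x z"
  by (simp add: marg_def)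

lemma marg_nonneg: "pmfs A q \<Longrightarrow> (\<And>x. 0 \<le> V x z) \<Longrightarrow> 0 \<le> marg A q V S x z"
  unfolding marg_def by (rule expect_nonneg)

lemma expect_marg: "pmfs A q \<Longrightarrow> expect A q (\<lambda>x. marg A q V S x z) = expect A q (\<lambda>x. V x z)"
  unfolding marg_def by (rule expect_mix)

text \<open>Tower property: invariance under \<open>mix\<close> says that \<open>G\<close> depends
  only on the coordinates in \<open>S\<close>.\<close>

lemma expect_marg_mult:
  assumes "pmfs A q" "\<And>x y. G (mix S x y) = G x"
  shows "expect A q (\<lambda>x. V x z * G x) = expect A q (\<lambda>x. marg A q V S x z * G x)"
  unfolding marg_def expect_multc[symmetric]
  by (subst expect_mix[OF assms(1), of "\<lambda>x. V x z * G x" S, symmetric]) (simp add: assms(2))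

definition uniform :: "('l \<Rightarrow> 'm set) \<Rightarrow> 'l \<Rightarrow> 'm \<Rightarrow> real" where
  "uniform I = (\<lambda>l _. 1 / real (card (I l)))"

lemma pmfs_uniform: "(\<And>l. finite (I l)) \<Longrightarrow> (\<And>l. I l \<noteq> {}) \<Longrightarrow> pmfs I (uniform I)"
  by (auto simp: pmfs_def pmf_on_def uniform_def)

lemma expect_agree:
  assumes p: "pmfs A q" and x: "\<And>l. x l \<in> A l"
  shows "expect A q (\<lambda>y. \<Prod>l\<in>S. of_bool (x l = y l)) = (\<Prod>l\<in>S. q l (x l))"
proof -
  have split: "(\<Prod>l\<in>S. f l) = (\<Prod>l\<in>UNIV. if l \<in> S then f l else 1)" for f :: "'a \<Rightarrow> real"
    by (simp add: prod.If_cases)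
  have fin: "finite (A l)" for l by (rule pmfs_finite[OF p])
  have "expect A q (\<lambda>y. \<Prod>l\<in>S. of_bool (x l = y l)) =
    (\<Prod>l\<in>UNIV. \<Sum>b\<in>A l. q l b * (if l \<in> S then of_bool (x l = b) else 1))"
    unfolding expect_def split by (subst prod_sum_PiE) (auto simp: fin prod.distrib)
  also have "\<dots> = (\<Prod>l\<in>UNIV. if l \<in> S then q l (x l) else 1)"
  proof (intro prod.cong refl)
    fix l
    have "(\<Sum>b\<in>A l. q l b * of_bool (x l = b)) = (\<Sum>b\<in>A l. if x l = b then q l b else 0)"
      by (intro sum.cong) auto
    also have "\<dots> = q l (x l)"
      using x[of l] fin[of l] by (simp add: sum.delta')
    finally show "(\<Sum>b\<in>A l. q l b * (if l \<in> S then of_bool (x l = b) else 1)) =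
        (if l \<in> S then q l (x l) else 1)"
      using pmfs_sum[OF p, of l] by simp
  qed
  finally show ?thesis by (simp only: split)
qed

lemma expect_uniform_agree:
  assumes "\<And>l. finite (I l)" "\<And>l. I l \<noteq> {}" "\<And>l. s l \<in> I l"
  shows "expect I (uniform I) (\<lambda>s'. \<Prod>l\<in>S. of_bool (s l = s' l)) = (\<Prod>l\<in>S. 1 / real (card (I l)))"
  using expect_agree[OF pmfs_uniform[OF assms(1,2)] assms(3)] by (simp add: uniform_def)

text \<open>The value at the exact agreement set is dominated by the sum over all \<open>S\<close>
  on which the messages agree. The overcounting is harmless, and agreement on \<open>S\<close> has a
  simple product probability.\<close>

lemma expect_agree_le:
  fixes h :: "'l::finite set \<Rightarrow> real"
  assumes I: "\<And>l. finite (I l)" "\<And>l. I l \<noteq> {}" and s: "\<And>l. s l \<in> I l" and h: "\<And>S. 0 \<le> h S"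
  shows "expect I (uniform I) (\<lambda>s'. h {l. s l = s' l}) \<le> (\<Sum>S\<in>UNIV. (\<Prod>l\<in>S. 1 / real (card (I l))) * h S)"
proof -
  have "h {l. s l = s' l} \<le> (\<Sum>S\<in>UNIV. (\<Prod>l\<in>S. of_bool (s l = s' l)) * h S)" for s'
  proof -
    have "(\<Prod>l\<in>{l. s l = s' l}. of_bool (s l = s' l)) * h {l. s l = s' l} \<le>
        (\<Sum>S\<in>UNIV. (\<Prod>l\<in>S. of_bool (s l = s' l)) * h S)"
      by (rule member_le_sum) (auto intro!: mult_nonneg_nonneg h prod_nonneg)
    then show ?thesis by simp
  qed
  then have "expect I (uniform I) (\<lambda>s'. h {l. s l = s' l}) \<le>
      expect I (uniform I) (\<lambda>s'. \<Sum>S\<in>UNIV. (\<Prod>l\<in>S. of_bool (s l = s' l)) * h S)"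
    by (intro expect_mono pmfs_uniform I)
  also have "\<dots> = (\<Sum>S\<in>UNIV. (\<Prod>l\<in>S. 1 / real (card (I l))) * h S)"
    unfolding expect_sum expect_multc by (simp only: expect_uniform_agree[OF I s])
  finally show ?thesis .
qed

section \<open>Bounds by powers, divergence and Hellinger distance\<close>

lemma powr_one_plus_le:
  fixes u :: real
  assumes "0 \<le> u" "0 < \<rho>" "\<rho> \<le> 1"
  shows "(1 + u) powr \<rho> \<le> 1 + u powr \<rho>"
proof -
  have le: "x \<le> x powr \<rho>" if "0 \<le> x" "x \<le> 1" for x :: real
    using powr_mono'[of \<rho> 1 x] that assms by simp
  \<comment> \<open>After division by \<open>1 + u\<close> the two terms are fractions that sum to
    1, and a fraction can only grow when raised to a power \<open>\<rho> \<le> 1\<close>.\<close>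
  have "1 = 1 / (1 + u) + u / (1 + u)"
    using assms by (simp add: field_simps)
  also have "\<dots> \<le> (1 / (1 + u)) powr \<rho> + (u / (1 + u)) powr \<rho>"
    using assms by (intro add_mono le) auto
  also have "\<dots> = (1 + u powr \<rho>) / (1 + u) powr \<rho>"
    using assms by (simp add: powr_divide add_divide_distrib)
  finally show ?thesis
    using assms by (simp add: field_simps)
qed

text \<open>Turns the logarithm of a sum into a sum of powers at the price of
  \<open>1 / \<rho>\<close>: the argument is below the product of the \<open>1 + u i\<close>, and
  \<open>\<rho> * ln (1 + v) \<le> ln (1 + v powr \<rho>) \<le> v powr \<rho>\<close>.\<close>

lemma ln_one_plus_sum_le:
  fixes u :: "'i \<Rightarrow> real"
  assumes "finite J" "\<And>i. i \<in> J \<Longrightarrow> 0 \<le> u i" "0 < \<rho>" "\<rho> \<le> 1"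
  shows "ln (1 + (\<Sum>i\<in>J. u i)) \<le> (\<Sum>i\<in>J. u i powr \<rho> / \<rho>)"
proof -
  have one: "ln (1 + v) \<le> v powr \<rho> / \<rho>" if v: "0 \<le> v" for v :: real
  proof -
    have "\<rho> * ln (1 + v) = ln ((1 + v) powr \<rho>)" using v by (simp add: ln_powr)
    also have "\<dots> \<le> ln (1 + v powr \<rho>)"
      using v powr_one_plus_le[OF v assms(3,4)] by (subst ln_le_cancel_iff) (auto intro: add_pos_nonneg)
    also have "\<dots> \<le> v powr \<rho>" by (rule ln_add_one_self_le_self) simp
    finally show ?thesis using assms by (simp add: field_simps)
  qed
  have "1 + (\<Sum>i\<in>J. u i) \<le> (\<Prod>i\<in>J. 1 + u i)"
    using assms(1,2)
  proof (induction rule: finite_induct)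
    case (insert i F)
    then have IH: "1 + sum u F \<le> (\<Prod>i\<in>F. 1 + u i)" and nn: "0 \<le> u i" "0 \<le> sum u F"
      by (auto intro: sum_nonneg)
    have "1 + sum u (insert i F) \<le> (1 + u i) * (1 + sum u F)"
      using insert nn by (simp add: algebra_simps)
    also have "\<dots> \<le> (1 + u i) * (\<Prod>i\<in>F. 1 + u i)" using nn IH by (intro mult_left_mono) auto
    finally show ?case using insert by simp
  qed simp
  moreover have "0 < 1 + (\<Sum>i\<in>J. u i)" using sum_nonneg[of J u] assms(2) by fastforce
  ultimately have "ln (1 + (\<Sum>i\<in>J. u i)) \<le> ln (\<Prod>i\<in>J. 1 + u i)"
    by (subst ln_le_cancel_iff) auto
  also have "\<dots> = (\<Sum>i\<in>J. ln (1 + u i))"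
  proof (rule ln_prod[OF assms(1)])
    show "1 + u i \<noteq> 0" if "i \<in> J" for i using assms(2)[OF that] by linarith
  qed
  also have "\<dots> \<le> (\<Sum>i\<in>J. u i powr \<rho> / \<rho>)" by (intro sum_mono one assms(2))
  finally show ?thesis .
qed

text \<open>This is \<open>ln y \<le> y - 1\<close> at \<open>y = sqrt (q / p)\<close>. The terms
  \<open>- p + q\<close> make the bound hold pointwise and vanish later in the codebook
  mean.\<close>

lemma hellinger_le_divergence:
  fixes p q :: real
  assumes "0 \<le> p" "0 < q"
  shows "(sqrt p - sqrt q)\<^sup>2 \<le> p * ln (p / q) - p + q"
proof (cases "p = 0")
  case False
  then have p: "0 < p" using assms by simp
  have "ln (sqrt (q / p)) \<le> sqrt (q / p) - 1" using assms p by (intro ln_le_minus_one) simp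
  moreover have "ln (sqrt (q / p)) = - ln (p / q) / 2"
    using assms p by (simp add: ln_sqrt ln_div)
  ultimately have "p * (2 - 2 * sqrt (q / p)) \<le> p * ln (p / q)"
    using p by (intro mult_left_mono) auto
  moreover have "p * sqrt (q / p) = sqrt p * sqrt q"
    using p by (simp add: real_sqrt_divide field_simps)
  ultimately show ?thesis using assms p by (simp add: power2_diff algebra_simps)
qed (use assms in simp)

text \<open>Factor \<open>p z - q z\<close> as a difference of squares and apply Cauchy-Schwarz; the
  factor with the sums of roots is at most 4.\<close>

lemma variation_le_hellinger:
  fixes p q :: "'b \<Rightarrow> real"
  assumes "\<And>z. z \<in> B \<Longrightarrow> 0 \<le> p z" "\<And>z. z \<in> B \<Longrightarrow> 0 \<le> q z" "sum p B = 1" "sum q B = 1"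
  shows "(\<Sum>z\<in>B. \<bar>p z - q z\<bar>)\<^sup>2 \<le> 4 * (\<Sum>z\<in>B. (sqrt (p z) - sqrt (q z))\<^sup>2)"
proof -
  have "(\<Sum>z\<in>B. \<bar>p z - q z\<bar>) = (\<Sum>z\<in>B. \<bar>sqrt (p z) - sqrt (q z)\<bar> * (sqrt (p z) + sqrt (q z)))"
  proof (intro sum.cong refl)
    fix z assume z: "z \<in> B"
    have "p z - q z = (sqrt (p z) - sqrt (q z)) * (sqrt (p z) + sqrt (q z))"
      using assms(1,2)[OF z] by (simp add: algebra_simps)
    then show "\<bar>p z - q z\<bar> = \<bar>sqrt (p z) - sqrt (q z)\<bar> * (sqrt (p z) + sqrt (q z))"
      using assms(1,2)[OF z] by (simp add: abs_mult)
  qed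
  then have "(\<Sum>z\<in>B. \<bar>p z - q z\<bar>)\<^sup>2 \<le>
      (\<Sum>z\<in>B. \<bar>sqrt (p z) - sqrt (q z)\<bar>\<^sup>2) * (\<Sum>z\<in>B. (sqrt (p z) + sqrt (q z))\<^sup>2)"
    using Cauchy_Schwarz_ineq_sum[of "\<lambda>z. \<bar>sqrt (p z) - sqrt (q z)\<bar>" "\<lambda>z. sqrt (p z) + sqrt (q z)" B]
    by simp
  also have "\<dots> \<le> (\<Sum>z\<in>B. \<bar>sqrt (p z) - sqrt (q z)\<bar>\<^sup>2) * 4"
  proof (rule mult_left_mono)
    have "(\<Sum>z\<in>B. (sqrt (p z) + sqrt (q z))\<^sup>2) \<le> (\<Sum>z\<in>B. 2 * p z + 2 * q z)"
    proof (rule sum_mono)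
      fix z assume z: "z \<in> B"
      have "0 \<le> (sqrt (p z) - sqrt (q z))\<^sup>2" by simp
      then show "(sqrt (p z) + sqrt (q z))\<^sup>2 \<le> 2 * p z + 2 * q z"
        using assms(1,2)[OF z] by (simp add: power2_sum power2_diff)
    qed
    also have "\<dots> = 4" using assms by (simp add: sum.distrib flip: sum_distrib_left)
    finally show "(\<Sum>z\<in>B. (sqrt (p z) + sqrt (q z))\<^sup>2) \<le> 4" .
  qed (auto intro: sum_nonneg)
  finally show ?thesis by simp
qed

section \<open>One-shot soft covering\<close>

definition code_output ::
  "('l::finite \<Rightarrow> 'm set) \<Rightarrow> (('l \<Rightarrow> 'a) \<Rightarrow> 'b \<Rightarrow> real) \<Rightarrow> ('l \<Rightarrow> 'm \<Rightarrow> 'a) \<Rightarrow> 'b \<Rightarrow> real" where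
  "code_output I V c z = expect I (uniform I) (\<lambda>s. V (\<lambda>l. c l (s l)) z)"

text \<open>The alphabets are abstract because a block of channel uses is later treated as a single
  use whose input letters are words.\<close>

locale soft_cover =
  fixes A :: "'l::finite \<Rightarrow> 'a set" and q :: "'l \<Rightarrow> 'a \<Rightarrow> real"
    and V :: "('l \<Rightarrow> 'a) \<Rightarrow> 'b \<Rightarrow> real" and I :: "'l \<Rightarrow> 'm set" and \<rho> :: real
  assumes pm: "pmfs A q" and V0: "\<And>x z. 0 \<le> V x z"
    and I: "\<And>l. finite (I l)" "\<And>l. I l \<noteq> {}" and rho: "0 < \<rho>" "\<rho> \<le> 1"
begin

abbreviation "EA \<equiv> expect A q"
abbreviation "EC \<equiv> expect (codebooks I A) (codebook_law I q)"
abbreviation "ES \<equiv> expect I (uniform I)"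
abbreviation "Q z \<equiv> EA (\<lambda>x. V x z)"
abbreviation "m \<equiv> marg A q V"
abbreviation "invM S \<equiv> (\<Prod>l\<in>S. 1 / real (card (I l)))"
abbreviation "out \<equiv> code_output I V"

text \<open>The term stemming from message tuples that agree on \<open>S\<close>. Summed over
  \<open>z\<close>, the expectation is the exponential of \<open>\<rho>\<close> times a Renyi
  divergence of order \<open>1 + \<rho>\<close>.\<close>

definition "cover_bound S z = invM S powr \<rho> / \<rho> * EA (\<lambda>x. m S x z * (m S x z / Q z) powr \<rho>)"

lemma m0: "0 \<le> m S x z"
  by (intro marg_nonneg pm V0)

lemma Q0: "0 \<le> Q z"
  by (intro expect_nonneg pm V0)

lemma invM0: "0 \<le> invM S"
  by (intro prod_nonneg) auto

lemma out0: "0 \<le> out c z"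
  unfolding code_output_def by (intro expect_nonneg pmfs_uniform I V0)

lemma pmc: "pmfs (codebooks I A) (codebook_law I q)"
  by (intro pmfs_codebooks pm I)

lemma pmu: "pmfs I (uniform I)"
  by (intro pmfs_uniform I)

lemma expect_output: "EC (\<lambda>c. out c z) = Q z"
proof -
  have "EC (\<lambda>c. out c z) = ES (\<lambda>s. EC (\<lambda>c. V (\<lambda>l. c l (s l)) z))"
    unfolding code_output_def by (rule expect_swap)
  also have "\<dots> = ES (\<lambda>s. Q z)"
    by (intro expect_cong expect_codeword[OF pm I(1), where F = "\<lambda>x. V x z"]) auto
  finally show ?thesis by (simp add: expect_const[OF pmu])
qed

lemma cover_bound_nonneg: "0 \<le> cover_bound S z"
  unfolding cover_bound_def using rho m0
  by (intro mult_nonneg_nonneg divide_nonneg_nonneg expect_nonneg[OF pm]) auto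

text \<open>Instead of conditioning on the transmitted codewords and applying Jensen's inequality, the
  logarithm is bounded by its tangent at the would-be conditional mean \<open>K x\<close>.\<close>

lemma expect_divergence_le:
  assumes Qp: "0 < Q z"
  shows "EC (\<lambda>c. out c z * ln (out c z / Q z)) \<le> (\<Sum>S\<in>UNIV - {{}}. cover_bound S z)"
proof -
  \<comment> \<open>By the bound on agreement sets, \<open>K x\<close> dominates the mean of
    \<open>out c z / Q z\<close> given that codeword \<open>x\<close> is sent. The term for
    \<open>S = {}\<close> is exactly 1, so dividing by \<open>K x\<close> is safe.\<close>
  define K where "K x = (\<Sum>S\<in>UNIV. invM S * (m S x z / Q z))" for x
  have K1: "K x = 1 + (\<Sum>S\<in>UNIV - {{}}. invM S * (m S x z / Q z))" for x
    using Qp unfolding K_def by (subst sum.remove[of _ "{}"]) (auto simp: marg_empty)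
  have Kge: "1 \<le> K x" for x
    unfolding K1 using Qp
    by (auto intro!: sum_nonneg mult_nonneg_nonneg divide_nonneg_nonneg m0 invM0)
  let ?cw = "\<lambda>c (s::'l \<Rightarrow> 'm) l. c l (s l) :: 'a"
  have tangent: "out c z * ln (out c z / Q z) \<le>
      ES (\<lambda>s. V (?cw c s) z * (ln (K (?cw c s)) + out c z / Q z / K (?cw c s) - 1))" for c
  proof (cases "out c z = 0")
    case True
    \<comment> \<open>A vanishing average of nonnegative terms has vanishing terms, so the
      right-hand side is 0 whatever the bracket contains.\<close>
    have "(\<Prod>l\<in>UNIV. uniform I l (s l)) * V (?cw c s) z = 0" if "s \<in> Pi\<^sub>E UNIV I" for s
    proof -
      have "(\<Sum>s\<in>Pi\<^sub>E UNIV I. (\<Prod>l\<in>UNIV. uniform I l (s l)) * V (?cw c s) z) = 0"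
        using True by (simp add: code_output_def expect_def)
      then show ?thesis
        using that by (subst (asm) sum_nonneg_eq_0_iff)
          (auto intro!: finite_PiE I V0 mult_nonneg_nonneg weight_nonneg[OF pmu])
    qed
    then have "ES (\<lambda>s. V (?cw c s) z * (ln (K (?cw c s)) + out c z / Q z / K (?cw c s) - 1)) = 0"
      unfolding expect_def by (intro sum.neutral) (simp only: mult.assoc[symmetric], simp)
    then show ?thesis using True by simp
  next
    case False
    then have op: "0 < out c z" using out0[of c z] by simp
    have "out c z * ln (out c z / Q z) = ES (\<lambda>s. V (?cw c s) z * ln (out c z / Q z))"
      by (subst (1) code_output_def) (simp only: expect_multc)
    also have "\<dots> \<le> ES (\<lambda>s. V (?cw c s) z * (ln (K (?cw c s)) + out c z / Q z / K (?cw c s) - 1))"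
    proof (intro expect_mono[OF pmu] mult_left_mono V0)
      fix s
      have Kp: "0 < K (?cw c s)" using Kge[of "?cw c s"] by linarith
      have "ln (out c z / Q z / K (?cw c s)) \<le> out c z / Q z / K (?cw c s) - 1"
        using op Qp Kp by (intro ln_le_minus_one) simp
      moreover have "ln (out c z / Q z / K (?cw c s)) = ln (out c z / Q z) - ln (K (?cw c s))"
        using op Qp Kp by (subst ln_div) auto
      ultimately show "ln (out c z / Q z) \<le> ln (K (?cw c s)) + out c z / Q z / K (?cw c s) - 1"
        by linarith
    qed
    finally show ?thesis .
  qed
  have part1: "EC (\<lambda>c. ES (\<lambda>s. V (?cw c s) z * (ln (K (?cw c s)) - 1))) =
      EA (\<lambda>x. V x z * ln (K x)) - Q z"
  proof -
    have "EC (\<lambda>c. ES (\<lambda>s. V (?cw c s) z * (ln (K (?cw c s)) - 1))) =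
        ES (\<lambda>s. EA (\<lambda>x. V x z * (ln (K x) - 1)))"
      by (subst expect_swap, intro expect_cong
          expect_codeword[OF pm I(1), where F = "\<lambda>x. V x z * (ln (K x) - 1)"]) auto
    then show ?thesis by (simp add: expect_const[OF pmu] right_diff_distrib expect_diff)
  qed
  \<comment> \<open>Expanding \<open>out c z\<close> introduces a second message tuple. Averaging
    over its agreement set sums the \<open>m S x z / Q z\<close> up to \<open>K x\<close>, which
    cancels the denominator; the resulting \<open>Q z\<close> offsets the \<open>- Q z\<close> of
    \<open>part1\<close>.\<close>
  have part2: "EC (\<lambda>c. ES (\<lambda>s. V (?cw c s) z * (out c z / Q z / K (?cw c s)))) \<le> Q z"
  proof -
    let ?h = "\<lambda>S. EA (\<lambda>x. V x z / K x * (m S x z / Q z))"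
    have h0: "0 \<le> ?h S" for S
    proof (intro expect_nonneg[OF pm] mult_nonneg_nonneg divide_nonneg_nonneg V0 m0 Q0)
      show "0 \<le> K x" for x using Kge[of x] by linarith
    qed
    have "EC (\<lambda>c. ES (\<lambda>s. V (?cw c s) z * (out c z / Q z / K (?cw c s)))) =
      EC (\<lambda>c. ES (\<lambda>s. ES (\<lambda>s'. V (?cw c s) z / K (?cw c s) / Q z * V (?cw c s') z)))"
      unfolding expect_cmult code_output_def by (simp add: field_simps)
    also have "\<dots> = ES (\<lambda>s. ES (\<lambda>s'. EC (\<lambda>c. V (?cw c s) z / K (?cw c s) / Q z * V (?cw c s') z)))"
      by (subst expect_swap, intro expect_cong, rule expect_swap)
    also have "\<dots> = ES (\<lambda>s. ES (\<lambda>s'. ?h {l. s l = s' l}))"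
    proof (intro expect_cong)
      fix s s' assume "s \<in> Pi\<^sub>E UNIV I" "s' \<in> Pi\<^sub>E UNIV I"
      then have s: "\<And>l. s l \<in> I l" "\<And>l. s' l \<in> I l" by auto
      have "EC (\<lambda>c. V (?cw c s) z / K (?cw c s) / Q z * V (?cw c s') z) =
          EA (\<lambda>x. EA (\<lambda>y. V x z / K x / Q z * V (mix {l. s l = s' l} x y) z))"
        by (rule expect_codebook[OF pm I(1) s, where F = "\<lambda>x y. V x z / K x / Q z * V y z"])
      also have "\<dots> = ?h {l. s l = s' l}"
        unfolding expect_cmult marg_def by simp
      finally show "EC (\<lambda>c. V (?cw c s) z / K (?cw c s) / Q z * V (?cw c s') z) = ?h {l. s l = s' l}" .
    qed
    also have "\<dots> \<le> ES (\<lambda>s. \<Sum>S\<in>UNIV. invM S * ?h S)"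
      by (intro expect_mono[OF pmu] expect_agree_le I h0) auto
    also have "\<dots> = (\<Sum>S\<in>UNIV. EA (\<lambda>x. V x z / K x * (invM S * (m S x z / Q z))))"
      unfolding expect_const[OF pmu] expect_cmult[symmetric] by (simp only: mult.left_commute)
    also have "\<dots> = EA (\<lambda>x. V x z / K x * K x)"
      unfolding expect_sum[symmetric] sum_distrib_left[symmetric] K_def ..
    also have "\<dots> = Q z"
    proof (intro expect_cong)
      show "V x z / K x * K x = V x z" for x using Kge[of x] by simp
    qed
    finally show ?thesis .
  qed
  have "EC (\<lambda>c. out c z * ln (out c z / Q z)) \<le>
    EC (\<lambda>c. ES (\<lambda>s. V (?cw c s) z * (ln (K (?cw c s)) + out c z / Q z / K (?cw c s) - 1)))"
    by (intro expect_mono[OF pmc] tangent)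
  also have "\<dots> = EC (\<lambda>c. ES (\<lambda>s. V (?cw c s) z * (ln (K (?cw c s)) - 1))) +
      EC (\<lambda>c. ES (\<lambda>s. V (?cw c s) z * (out c z / Q z / K (?cw c s))))"
    unfolding expect_add[symmetric] by (simp add: algebra_simps)
  also have "\<dots> \<le> EA (\<lambda>x. V x z * ln (K x))"
    using part1 part2 by simp
  also have "\<dots> \<le> EA (\<lambda>x. V x z * (\<Sum>S\<in>UNIV - {{}}. (invM S * (m S x z / Q z)) powr \<rho> / \<rho>))"
    unfolding K1
    by (intro expect_mono[OF pm] mult_left_mono ln_one_plus_sum_le V0 rho
        mult_nonneg_nonneg divide_nonneg_nonneg m0 invM0 Q0) auto
  also have "\<dots> = (\<Sum>S\<in>UNIV - {{}}. EA (\<lambda>x. V x z * ((invM S * (m S x z / Q z)) powr \<rho> / \<rho>)))"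
    unfolding sum_distrib_left expect_sum by simp
  also have "\<dots> = (\<Sum>S\<in>UNIV - {{}}. cover_bound S z)"
  proof (intro sum.cong refl)
    fix S
    \<comment> \<open>The power depends only on the inputs in \<open>S\<close>, so \<open>V\<close>
      may be replaced by its average given those inputs.\<close>
    have "EA (\<lambda>x. V x z * ((invM S * (m S x z / Q z)) powr \<rho> / \<rho>)) =
        EA (\<lambda>x. m S x z * ((invM S * (m S x z / Q z)) powr \<rho> / \<rho>))"
      by (rule expect_marg_mult[OF pm]) simp
    also have "\<dots> = cover_bound S z"
      unfolding cover_bound_def expect_cmult[symmetric]
      using m0 Q0 invM0 by (intro expect_cong, subst powr_mult) (auto simp: mult_ac)
    finally show "EA (\<lambda>x. V x z * ((invM S * (m S x z / Q z)) powr \<rho> / \<rho>)) = cover_bound S z" .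
  qed
  finally show ?thesis .
qed

text \<open>The squared Hellinger distance is averaged over codebooks and bounded through the
  divergence; a codebook no worse than average is fixed before passing to variation
  distance.\<close>

theorem exists_soft_covering:
  assumes B: "\<And>x. (\<Sum>z\<in>B. V x z) = 1"
  shows "\<exists>c\<in>Pi\<^sub>E UNIV (codebooks I A). (\<Sum>z\<in>B. \<bar>out c z - Q z\<bar>)\<^sup>2 \<le>
    4 * (\<Sum>S\<in>UNIV - {{}}. \<Sum>z\<in>B. cover_bound S z)"
proof -
  have "EC (\<lambda>c. (sqrt (out c z) - sqrt (Q z))\<^sup>2) \<le> (\<Sum>S\<in>UNIV - {{}}. cover_bound S z)" for z
  proof (cases "Q z = 0")
    case True
    \<comment> \<open>With \<open>Q z = 0\<close> the square is \<open>out c z\<close> itself, whose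
      codebook mean is \<open>Q z\<close>.\<close>
    have "EC (\<lambda>c. (sqrt (out c z) - sqrt (Q z))\<^sup>2) = EC (\<lambda>c. out c z)"
      unfolding True by (simp add: out0)
    then show ?thesis using True by (simp add: expect_output sum_nonneg cover_bound_nonneg)
  next
    case False
    then have Qp: "0 < Q z" using Q0[of z] by linarith
    have "EC (\<lambda>c. (sqrt (out c z) - sqrt (Q z))\<^sup>2) \<le>
        EC (\<lambda>c. out c z * ln (out c z / Q z) - out c z + Q z)"
      by (intro expect_mono[OF pmc] hellinger_le_divergence out0 Qp)
    also have "\<dots> = EC (\<lambda>c. out c z * ln (out c z / Q z))"
      unfolding expect_add expect_diff expect_output expect_const[OF pmc] by simp
    also note expect_divergence_le[OF Qp]
    finally show ?thesis .
  qed
  then have "EC (\<lambda>c. \<Sum>z\<in>B. (sqrt (out c z) - sqrt (Q z))\<^sup>2) \<le>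
      (\<Sum>z\<in>B. \<Sum>S\<in>UNIV - {{}}. cover_bound S z)"
    unfolding expect_sum by (intro sum_mono)
  then obtain c where c: "c \<in> Pi\<^sub>E UNIV (codebooks I A)"
    "(\<Sum>z\<in>B. (sqrt (out c z) - sqrt (Q z))\<^sup>2) \<le> (\<Sum>z\<in>B. \<Sum>S\<in>UNIV - {{}}. cover_bound S z)"
    using expect_exists_le[OF pmc] by blast
  have "sum (out c) B = 1" "sum Q B = 1"
    unfolding code_output_def expect_sum[symmetric]
    by (simp_all add: B expect_const[OF pmu] expect_const[OF pm])
  then have "(\<Sum>z\<in>B. \<bar>out c z - Q z\<bar>)\<^sup>2 \<le> 4 * (\<Sum>z\<in>B. (sqrt (out c z) - sqrt (Q z))\<^sup>2)"
    by (intro variation_le_hellinger out0 Q0)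
  then show ?thesis using c sum.swap[of "\<lambda>z S. cover_bound S z" "UNIV - {{}}" B]
    by (intro bexI[of _ c]) auto
qed

end

section \<open>Converse bound for a single code\<close>

definition xlnx :: "real \<Rightarrow> real" where
  "xlnx u = u * ln u"

lemma xlnx_0 [simp]: "xlnx 0 = 0"
  by (simp add: xlnx_def)

text \<open>For \<open>p \<le> q\<close> this is superadditivity of \<open>u * ln u\<close>; for
  \<open>q < p\<close> the bound \<open>p - q\<close> comes from \<open>ln y \<le> y - 1\<close> and
  \<open>ln p \<le> 0\<close>.\<close>

lemma xlnx_diff_le:
  assumes "0 \<le> p" "p \<le> 1" "0 \<le> q" "q \<le> 1"
  shows "xlnx p - xlnx q \<le> \<bar>p - q\<bar> - xlnx \<bar>p - q\<bar>"
proof -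
  have neg: "xlnx d \<le> 0" if "0 \<le> d" "d \<le> 1" for d
  proof (cases "d = 0")
    case False
    then have "ln d \<le> 0" using that by simp
    then show ?thesis using that by (simp add: xlnx_def mult_nonneg_nonpos)
  qed simp
  show ?thesis
  proof (cases "p \<le> q")
    case True
    have "xlnx p + xlnx (q - p) \<le> xlnx q"
    proof -
      have "u * ln u \<le> u * ln q" if "0 \<le> u" "u \<le> q" for u
        using that by (cases "u = 0") (auto intro!: mult_left_mono)
      from this[of p] this[of "q - p"] show ?thesis
        using assms True by (simp add: xlnx_def algebra_simps)
    qed
    then show ?thesis using True by simp
  next
    case False
    have "xlnx p - xlnx q \<le> p - q"
    proof (cases "q = 0")
      case True
      then show ?thesis using neg[of p] assms by simp
    next
      case q: False
      then have qp: "0 < q" using assms by simp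
      have "ln (p / q) \<le> p / q - 1" using False qp by (intro ln_le_minus_one) auto
      then have "q * ln (p / q) \<le> q * (p / q - 1)" using qp by (intro mult_left_mono) auto
      then have "q * ln p - q * ln q \<le> p - q"
        using qp False by (simp add: ln_div algebra_simps)
      moreover have "(p - q) * ln p \<le> 0" using assms False qp by (intro mult_nonneg_nonpos) auto
      ultimately show ?thesis by (simp add: xlnx_def algebra_simps)
    qed
    then show ?thesis using False neg[of "p - q"] assms by simp
  qed
qed

text \<open>A crude Fannes-type bound. The additive 1 does not depend on the alphabet and disappears
  after division by the blocklength.\<close>

lemma sum_xlnx_diff_le:
  fixes p q :: "'b \<Rightarrow> real"
  assumes B: "finite B" "B \<noteq> {}" and p: "\<And>z. z \<in> B \<Longrightarrow> 0 \<le> p z" "sum p B = 1"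
    and q: "\<And>z. z \<in> B \<Longrightarrow> 0 \<le> q z" "sum q B = 1"
  shows "(\<Sum>z\<in>B. xlnx (p z)) - (\<Sum>z\<in>B. xlnx (q z)) \<le> (\<Sum>z\<in>B. \<bar>p z - q z\<bar>) * ln (card B) + 1"
proof -
  have K: "0 < real (card B)" using B by (simp add: card_gt_0_iff)
  have le1: "r z \<le> 1" if "z \<in> B" "\<And>z. z \<in> B \<Longrightarrow> 0 \<le> r z" "sum r B = 1" for r :: "'b \<Rightarrow> real" and z
    using member_le_sum[of z B r] that B by auto
  have pt: "xlnx (p z) - xlnx (q z) \<le> \<bar>p z - q z\<bar> * ln (card B) + 1 / card B" if z: "z \<in> B" for z
  proof -
    define d where "d = \<bar>p z - q z\<bar>"
    \<comment> \<open>The concave function \<open>- xlnx\<close> lies below its tangent at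
      \<open>1 / card B\<close>.\<close>
    have "- xlnx d \<le> 1 / card B - d + d * ln (card B)"
    proof (cases "d = 0")
      case False
      then have d: "0 < d" by (simp add: d_def)
      have "ln (1 / (d * card B)) \<le> 1 / (d * card B) - 1" using d K by (intro ln_le_minus_one) simp
      then have "d * ln (1 / (d * card B)) \<le> d * (1 / (d * card B) - 1)"
        using d by (intro mult_left_mono) auto
      then show ?thesis using d K by (simp add: ln_div ln_mult xlnx_def algebra_simps)
    qed simp
    moreover have "xlnx (p z) - xlnx (q z) \<le> d - xlnx d"
      unfolding d_def using z p q by (intro xlnx_diff_le le1) auto
    ultimately show ?thesis unfolding d_def by linarith
  qed
  have "(\<Sum>z\<in>B. xlnx (p z)) - (\<Sum>z\<in>B. xlnx (q z)) = (\<Sum>z\<in>B. xlnx (p z) - xlnx (q z))"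
    by (simp add: sum_subtractf)
  also have "\<dots> \<le> (\<Sum>z\<in>B. \<bar>p z - q z\<bar> * ln (card B) + 1 / card B)"
    by (intro sum_mono pt)
  also have "\<dots> = (\<Sum>z\<in>B. \<bar>p z - q z\<bar>) * ln (card B) + 1"
    using K by (simp add: sum.distrib sum_distrib_right)
  finally show ?thesis .
qed

text \<open>Gibbs' inequality before summation: for two probability vectors the terms
  \<open>p - q\<close> cancel in total.\<close>

lemma gibbs_pointwise:
  fixes p q :: real
  assumes "0 \<le> p" "0 \<le> q" "0 < p \<Longrightarrow> 0 < q"
  shows "p * ln q + p - q \<le> xlnx p"
proof (cases "p = 0")
  case False
  then have pq: "0 < p" "0 < q" using assms by auto
  have "ln (q / p) \<le> q / p - 1" using pq by (intro ln_le_minus_one) simp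
  then have "p * ln (q / p) \<le> p * (q / p - 1)" using pq by (intro mult_left_mono) auto
  then show ?thesis using pq by (simp add: xlnx_def ln_div algebra_simps)
qed (use assms in simp)

section \<open>Words over the output alphabet\<close>

abbreviation words :: "nat \<Rightarrow> (nat \<Rightarrow> 'z::finite) set" where
  "words N \<equiv> Pi\<^sub>E {..<N} (\<lambda>_. UNIV)"

lemma finite_words: "finite (words N)"
  by (intro finite_PiE) auto

lemma sum_words_prod:
  fixes r :: "nat \<Rightarrow> 'z::finite \<Rightarrow> real"
  shows "(\<Sum>zs\<in>words N. \<Prod>i<N. r i (zs i)) = (\<Prod>i<N. \<Sum>z\<in>UNIV. r i z)"
  by (subst prod_sum_PiE) auto

lemma sum_words_marginal:
  fixes r :: "nat \<Rightarrow> 'z::finite \<Rightarrow> real"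
  assumes r: "\<And>i. i < N \<Longrightarrow> (\<Sum>z\<in>UNIV. r i z) = 1" and j: "j < N"
  shows "(\<Sum>zs\<in>words N. (\<Prod>i<N. r i (zs i)) * g (zs j)) = (\<Sum>z\<in>UNIV. r j z * g z)"
proof -
  have "(\<Sum>zs\<in>words N. (\<Prod>i<N. r i (zs i)) * g (zs j)) =
      (\<Sum>zs\<in>words N. \<Prod>i<N. r i (zs i) * (if i = j then g (zs i) else 1))"
    using j by (simp add: prod.distrib prod.delta')
  also have "\<dots> = (\<Prod>i<N. \<Sum>z\<in>UNIV. r i z * (if i = j then g z else 1))"
    by (rule sum_words_prod)
  also have "\<dots> = (\<Prod>i<N. if i = j then \<Sum>z\<in>UNIV. r i z * g z else 1)"
    by (intro prod.cong) (auto simp: r)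
  finally show ?thesis using j by (simp add: prod.delta')
qed

text \<open>Additivity of entropy for product laws: split the logarithm and marginalise. Words of
  probability 0 contribute nothing to either form.\<close>

lemma sum_words_xlnx:
  fixes r :: "'z::finite \<Rightarrow> real"
  assumes r: "(\<Sum>z\<in>UNIV. r z) = 1" "\<And>z. 0 \<le> r z"
  shows "(\<Sum>zs\<in>words N. xlnx (\<Prod>i<N. r (zs i))) = real N * (\<Sum>z\<in>UNIV. xlnx (r z))"
proof -
  have "xlnx (\<Prod>i<N. r (zs i)) = (\<Sum>j<N. (\<Prod>i<N. r (zs i)) * ln (r (zs j)))" for zs
  proof (cases "(\<Prod>i<N. r (zs i)) = 0")
    case False
    then have "ln (\<Prod>i<N. r (zs i)) = (\<Sum>j<N. ln (r (zs j)))"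
      by (intro ln_prod) auto
    then show ?thesis by (simp add: xlnx_def sum_distrib_left)
  next
    case True
    then show ?thesis by (simp only: True xlnx_0 mult_zero_left sum.neutral_const)
  qed
  then have "(\<Sum>zs\<in>words N. xlnx (\<Prod>i<N. r (zs i))) =
      (\<Sum>j<N. \<Sum>zs\<in>words N. (\<Prod>i<N. r (zs i)) * ln (r (zs j)))"
    by (simp only:) (rule sum.swap)
  also have "\<dots> = (\<Sum>j<N. \<Sum>z\<in>UNIV. xlnx (r z))"
    by (intro sum.cong refl) (simp add: sum_words_marginal[OF r(1), where g = "\<lambda>z. ln (r z)"] xlnx_def)
  finally show ?thesis by simp
qed

section \<open>Block channel and binary input laws\<close>

definition block ::
  "(('l \<Rightarrow> bool) \<Rightarrow> 'z::finite \<Rightarrow> real) \<Rightarrow> nat \<Rightarrow> ('l \<Rightarrow> nat \<Rightarrow> bool) \<Rightarrow> (nat \<Rightarrow> 'z) \<Rightarrow> real" where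
  "block W N x zs = (\<Prod>i<N. W (\<lambda>l. x l i) (zs i))"

text \<open>Binary input laws are encoded by the vector of probabilities of \<open>True\<close>, so
  that they form a compact subset of a Euclidean space.\<close>

definition bern :: "real ^ 'l \<Rightarrow> 'l \<Rightarrow> bool \<Rightarrow> real" where
  "bern a l b = (if b then a $ l else 1 - a $ l)"

abbreviation bits :: "'l \<Rightarrow> bool set" where
  "bits \<equiv> (\<lambda>_. UNIV)"

text \<open>Minus the conditional entropy, in nats, of the output given the inputs in
  \<open>S\<close>.\<close>

definition neg_entropy ::
  "(('l::finite \<Rightarrow> bool) \<Rightarrow> 'z::finite \<Rightarrow> real) \<Rightarrow> real ^ 'l \<Rightarrow> 'l set \<Rightarrow> real" where
  "neg_entropy W a S = expect bits (bern a) (\<lambda>x. \<Sum>z\<in>UNIV. xlnx (marg bits (bern a) W S x z))"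

lemma channel_nonneg: "channel W \<Longrightarrow> 0 \<le> W x z"
  and channel_sum: "channel W \<Longrightarrow> (\<Sum>z\<in>UNIV. W x z) = 1"
  by (auto simp: channel_def)

lemma block_nonneg: "channel W \<Longrightarrow> 0 \<le> block W N x zs"
  unfolding block_def by (intro prod_nonneg) (simp add: channel_nonneg)

lemma block_sum: "channel W \<Longrightarrow> (\<Sum>zs\<in>words N. block W N x zs) = 1"
  unfolding block_def using sum_words_prod[where r = "\<lambda>i. W (\<lambda>l. x l i)"] by (simp add: channel_sum)

lemma block_marginal:
  "channel W \<Longrightarrow> j < N \<Longrightarrow>
    (\<Sum>zs\<in>words N. block W N x zs * g (zs j)) = (\<Sum>z\<in>UNIV. W (\<lambda>l. x l j) z * g z)"
  unfolding block_def by (rule sum_words_marginal) (auto simp: channel_sum)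

section \<open>Letterwise and blockwise output laws of a fixed code\<close>

locale code =
  fixes W :: "('l::finite \<Rightarrow> bool) \<Rightarrow> 'z::finite \<Rightarrow> real"
    and I :: "'l \<Rightarrow> 'm set" and f :: "'l \<Rightarrow> 'm \<Rightarrow> nat \<Rightarrow> bool" and N :: nat
  assumes W: "channel W" and I: "\<And>l. finite (I l)" "\<And>l. I l \<noteq> {}"
begin

abbreviation "ES \<equiv> expect I (uniform I)"
abbreviation "p \<equiv> code_output I (block W N) f"

text \<open>The average is over messages, not over time: under uniform messages the symbols at time
  \<open>i\<close> are independent with these probabilities of \<open>True\<close>.\<close>

definition bias :: "nat \<Rightarrow> real ^ 'l" where
  "bias i = (\<chi> l. real (card {s \<in> I l. f l s i}) / real (card (I l)))"

lemma pmu: "pmfs I (uniform I)"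
  by (intro pmfs_uniform I)

lemma p_nonneg: "0 \<le> p zs"
  unfolding code_output_def by (intro expect_nonneg pmu block_nonneg W)

lemma p_sum: "(\<Sum>zs\<in>words N. p zs) = 1"
  unfolding code_output_def expect_sum[symmetric] by (simp add: block_sum W expect_const[OF pmu])

lemma expect_letter: "ES (\<lambda>s. G (\<lambda>l. f l (s l) i)) = expect bits (bern (bias i)) G"
proof (rule expect_push[where g = "\<lambda>l s. f l s i"])
  fix l b
  have "card (I l) = card {s \<in> I l. f l s i} + card {s \<in> I l. \<not> f l s i}"
    by (subst card_Un_disjoint[symmetric]) (auto simp: I intro!: arg_cong[where f = card])
  then have "real (card {s \<in> I l. \<not> f l s i}) = real (card (I l)) - real (card {s \<in> I l. f l s i})"
    by linarith
  moreover have "0 < card (I l)" using I[of l] by (simp add: card_gt_0_iff)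
  ultimately show "(\<Sum>s\<in>{s \<in> I l. f l s i = b}. uniform I l s) = bern (bias i) l b"
    by (cases b) (simp_all add: uniform_def bern_def bias_def diff_divide_distrib)
qed (auto simp: I)

lemma bias_bounds: "0 \<le> bias i $ l" "bias i $ l \<le> 1"
proof -
  have "card {s \<in> I l. f l s i} \<le> card (I l)" by (intro card_mono) (auto simp: I)
  then show "0 \<le> bias i $ l" "bias i $ l \<le> 1"
    using I[of l] by (auto simp: bias_def divide_le_eq card_gt_0_iff)
qed

definition cond :: "'l set \<Rightarrow> ('l \<Rightarrow> 'm) \<Rightarrow> (nat \<Rightarrow> 'z) \<Rightarrow> real" where
  "cond S s zs = marg I (uniform I) (\<lambda>s. block W N (\<lambda>l. f l (s l))) S s zs"

text \<open>Conditions on the symbols at time \<open>i\<close> only; since the channel is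
  memoryless, this is nevertheless the marginal of \<open>cond\<close> at time
  \<open>i\<close>.\<close>

definition letter :: "'l set \<Rightarrow> ('l \<Rightarrow> 'm) \<Rightarrow> nat \<Rightarrow> 'z \<Rightarrow> real" where
  "letter S s i z = marg bits (bern (bias i)) W S (\<lambda>l. f l (s l) i) z"

lemma letter_eq: "letter S s i z = ES (\<lambda>s'. W (\<lambda>l. f l (mix S s s' l) i) z)"
proof -
  have "(\<lambda>l. f l (mix S s s' l) i) = mix S (\<lambda>l. f l (s l) i) (\<lambda>l. f l (s' l) i)" for s'
    by (auto simp: mix_def)
  then show ?thesis
    unfolding letter_def marg_def
    by (simp only: expect_letter[where G = "\<lambda>y. W (mix S (\<lambda>l. f l (s l) i) y) z"])
qed

lemma letter_nonneg: "0 \<le> letter S s i z"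
  unfolding letter_eq by (intro expect_nonneg pmu channel_nonneg W)

lemma letter_sum: "(\<Sum>z\<in>UNIV. letter S s i z) = 1"
  unfolding letter_eq expect_sum[symmetric] by (simp add: channel_sum W expect_const[OF pmu])

lemma cond_nonneg: "0 \<le> cond S s zs"
  unfolding cond_def by (intro marg_nonneg pmu block_nonneg W)

lemma cond_sum: "(\<Sum>zs\<in>words N. cond S s zs) = 1"
  unfolding cond_def marg_def expect_sum[symmetric] by (simp add: block_sum W expect_const[OF pmu])

lemma cond_marginal:
  assumes "j < N"
  shows "(\<Sum>zs\<in>words N. cond S s zs * g (zs j)) = (\<Sum>z\<in>UNIV. letter S s j z * g z)"
  unfolding cond_def marg_def letter_eq expect_multc[symmetric] expect_sum[symmetric]
  by (simp only: block_marginal[OF W assms])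

lemma expect_cond: "ES (\<lambda>s. cond S s zs) = p zs"
  unfolding cond_def code_output_def by (rule expect_marg[OF pmu])

text \<open>Message tuples agreeing with \<open>s\<close> on \<open>S\<close> give the same
  conditional law, and their probability is one over the number of message choices in
  \<open>S\<close>. They form part of the mixture \<open>p\<close>.\<close>

lemma cond_le:
  assumes s: "\<And>l. s l \<in> I l"
  shows "cond S s zs \<le> (\<Prod>l\<in>S. real (card (I l))) * p zs"
proof -
  have pos: "0 < (\<Prod>l\<in>S. real (card (I l)))"
    using I by (intro prod_pos) (auto simp: card_gt_0_iff)
  have "(\<Prod>l\<in>S. 1 / real (card (I l))) * cond S s zs =
      ES (\<lambda>s'. (\<Prod>l\<in>S. of_bool (s l = s' l)) * cond S s zs)"
    unfolding expect_multc expect_uniform_agree[OF I s] ..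
  also have "\<dots> \<le> ES (\<lambda>s'. cond S s' zs)"
  proof (rule expect_mono[OF pmu])
    fix s'
    show "(\<Prod>l\<in>S. of_bool (s l = s' l)) * cond S s zs \<le> cond S s' zs"
    proof (cases "\<forall>l\<in>S. s l = s' l")
      case True
      then have "mix S s = mix S s'" by (auto simp: mix_def fun_eq_iff)
      then show ?thesis using True by (simp add: cond_def marg_def)
    next
      case False
      then have "(\<Prod>l\<in>S. of_bool (s l = s' l)) = (0::real)" by (intro prod_zero) auto
      then show ?thesis using cond_nonneg[of S s' zs] by (simp only: mult_zero_left)
    qed
  qed
  also have "\<dots> = p zs" by (rule expect_cond)
  finally show ?thesis using pos by (simp add: prod_dividef field_simps)
qed

text \<open>The information that the output carries about the messages in \<open>S\<close> is at
  most the logarithm of their number: take logarithms in \<open>cond_le\<close> and average.\<close>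

lemma sum_xlnx_cond_le:
  "ES (\<lambda>s. \<Sum>zs\<in>words N. xlnx (cond S s zs)) \<le>
    ln (\<Prod>l\<in>S. real (card (I l))) + (\<Sum>zs\<in>words N. xlnx (p zs))"
proof -
  let ?M = "\<Prod>l\<in>S. real (card (I l))"
  have M: "0 < ?M"
    using I by (intro prod_pos) (auto simp: card_gt_0_iff)
  have "ES (\<lambda>s. \<Sum>zs\<in>words N. xlnx (cond S s zs)) \<le>
      ES (\<lambda>s. \<Sum>zs\<in>words N. cond S s zs * (ln ?M + ln (p zs)))"
  proof (intro expect_mono[OF pmu] sum_mono)
    fix s zs assume s: "s \<in> Pi\<^sub>E UNIV I"
    show "xlnx (cond S s zs) \<le> cond S s zs * (ln ?M + ln (p zs))"
    proof (cases "cond S s zs = 0")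
      case False
      then have c: "0 < cond S s zs" using cond_nonneg[of S s zs] by simp
      have le: "cond S s zs \<le> ?M * p zs" using s by (intro cond_le) auto
      then have "0 < p zs" using c M p_nonneg[of zs] by (cases "p zs = 0") auto
      then have "ln (cond S s zs) \<le> ln ?M + ln (p zs)"
        using le c M by (subst ln_mult_pos[symmetric]) auto
      then show ?thesis using c by (simp add: xlnx_def)
    qed simp
  qed
  also have "\<dots> = (\<Sum>zs\<in>words N. p zs * (ln ?M + ln (p zs)))"
    unfolding expect_sum expect_multc expect_cond ..
  also have "\<dots> = ln ?M + (\<Sum>zs\<in>words N. xlnx (p zs))"
    using p_sum by (simp add: ring_distribs sum.distrib xlnx_def flip: sum_distrib_right)
  finally show ?thesis .
qed

text \<open>Subadditivity of entropy: Gibbs' inequality against the product of the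
  marginals.\<close>

lemma sum_xlnx_cond_ge:
  "(\<Sum>i<N. \<Sum>z\<in>UNIV. xlnx (letter S s i z)) \<le> (\<Sum>zs\<in>words N. xlnx (cond S s zs))"
proof -
  let ?Q = "\<lambda>zs. \<Prod>i<N. letter S s i (zs i)"
  \<comment> \<open>A marginal dominates each of its atoms. Hence \<open>?Q zs\<close> has no zero
    factor where \<open>cond S s zs\<close> is positive, and its logarithm splits.\<close>
  have pos: "0 < letter S s j (zs j)" if "0 < cond S s zs" "j < N" "zs \<in> words N" for zs j
  proof -
    have "cond S s zs * of_bool (zs j = zs j) \<le> (\<Sum>zs'\<in>words N. cond S s zs' * of_bool (zs' j = zs j))"
      using that(3) by (intro member_le_sum[of zs]) (auto simp: cond_nonneg finite_words)
    also have "\<dots> = letter S s j (zs j)"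
      by (subst cond_marginal[OF that(2)]) (simp add: sum.delta')
    finally show ?thesis using that by simp
  qed
  have "(\<Sum>i<N. \<Sum>z\<in>UNIV. xlnx (letter S s i z)) =
      (\<Sum>i<N. \<Sum>zs\<in>words N. cond S s zs * ln (letter S s i (zs i)))"
  proof (intro sum.cong refl)
    fix i assume "i \<in> {..<N}"
    then show "(\<Sum>z\<in>UNIV. xlnx (letter S s i z)) =
        (\<Sum>zs\<in>words N. cond S s zs * ln (letter S s i (zs i)))"
      using cond_marginal[of i S s "\<lambda>z. ln (letter S s i z)"] by (simp add: xlnx_def)
  qed
  also have "\<dots> = (\<Sum>zs\<in>words N. cond S s zs * (\<Sum>i<N. ln (letter S s i (zs i))))"
    unfolding sum_distrib_left by (rule sum.swap)
  also have "\<dots> = (\<Sum>zs\<in>words N. cond S s zs * ln (?Q zs))"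
  proof (intro sum.cong refl)
    fix zs :: "nat \<Rightarrow> 'z" assume zs: "zs \<in> words N"
    show "cond S s zs * (\<Sum>i<N. ln (letter S s i (zs i))) = cond S s zs * ln (?Q zs)"
    proof (cases "cond S s zs = 0")
      case False
      then have "0 < cond S s zs" using cond_nonneg[of S s zs] by simp
      then have "letter S s i (zs i) \<noteq> 0" if "i < N" for i using pos[OF _ that zs] by force
      then have "ln (?Q zs) = (\<Sum>i<N. ln (letter S s i (zs i)))" by (intro ln_prod) auto
      then show ?thesis by simp
    qed simp
  qed
  \<comment> \<open>Both laws have total mass 1, so adding their difference changes nothing and
    prepares the pointwise inequality.\<close>
  also have "\<dots> = (\<Sum>zs\<in>words N. cond S s zs * ln (?Q zs) + cond S s zs - ?Q zs)"
    using sum_words_prod[where r = "letter S s"]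
    by (simp add: sum.distrib sum_subtractf cond_sum letter_sum)
  also have "\<dots> \<le> (\<Sum>zs\<in>words N. xlnx (cond S s zs))"
    using pos by (intro sum_mono gibbs_pointwise cond_nonneg)
      (auto intro!: prod_nonneg prod_pos letter_nonneg)
  finally show ?thesis .
qed

text \<open>Letters are compared with block conditional laws, these with the output law
  \<open>p\<close>, and \<open>p\<close> with the target by continuity of entropy. The logarithm of
  the number of words is linear in \<open>N\<close>, so the error per letter vanishes with the
  variation distance.\<close>

theorem sum_neg_entropy_le:
  assumes q: "(\<Sum>z\<in>UNIV. q z) = 1" "\<And>z. 0 \<le> q z"
  shows "(\<Sum>i<N. neg_entropy W (bias i) S - (\<Sum>z\<in>UNIV. xlnx (q z))) \<le>
    ln (\<Prod>l\<in>S. real (card (I l))) +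
    (\<Sum>zs\<in>words N. \<bar>p zs - (\<Prod>i<N. q (zs i))\<bar>) * (real N * ln (real CARD('z))) + 1"
proof -
  have "neg_entropy W (bias i) S = ES (\<lambda>s. \<Sum>z\<in>UNIV. xlnx (letter S s i z))" for i
    unfolding neg_entropy_def letter_def
    by (rule expect_letter[symmetric, where G = "\<lambda>x. \<Sum>z\<in>UNIV. xlnx (marg bits (bern (bias i)) W S x z)"])
  then have "(\<Sum>i<N. neg_entropy W (bias i) S) =
      ES (\<lambda>s. \<Sum>i<N. \<Sum>z\<in>UNIV. xlnx (letter S s i z))"
    by (simp add: expect_sum)
  also have "\<dots> \<le> ES (\<lambda>s. \<Sum>zs\<in>words N. xlnx (cond S s zs))"
    by (intro expect_mono[OF pmu] sum_xlnx_cond_ge)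
  also note sum_xlnx_cond_le
  finally have "(\<Sum>i<N. neg_entropy W (bias i) S) \<le>
    ln (\<Prod>l\<in>S. real (card (I l))) + (\<Sum>zs\<in>words N. xlnx (p zs))" .
  moreover have "(\<Sum>zs\<in>words N. xlnx (p zs)) - (\<Sum>zs\<in>words N. xlnx (\<Prod>i<N. q (zs i))) \<le>
    (\<Sum>zs\<in>words N. \<bar>p zs - (\<Prod>i<N. q (zs i))\<bar>) * ln (card (words N :: (nat \<Rightarrow> 'z) set)) + 1"
    using p_sum sum_words_prod[where r = "\<lambda>_. q"]
    by (intro sum_xlnx_diff_le p_nonneg finite_words)
      (auto simp: PiE_eq_empty_iff q intro!: prod_nonneg)
  moreover have "ln (card (words N :: (nat \<Rightarrow> 'z) set)) = real N * ln (real CARD('z))"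
    by (simp add: card_PiE ln_realpow)
  ultimately show ?thesis
    by (simp add: sum_subtractf sum_words_xlnx[OF q])
qed

text \<open>Passing to a marginal cannot increase variation distance.\<close>

theorem letter_output_close:
  assumes q: "(\<Sum>z\<in>UNIV. q z) = 1" and i: "i < N"
  shows "(\<Sum>z\<in>UNIV. \<bar>expect bits (bern (bias i)) (\<lambda>x. W x z) - q z\<bar>) \<le>
    (\<Sum>zs\<in>words N. \<bar>p zs - (\<Prod>i<N. q (zs i))\<bar>)"
proof -
  have "expect bits (bern (bias i)) (\<lambda>x. W x z) - q z =
      (\<Sum>zs\<in>words N. (p zs - (\<Prod>i<N. q (zs i))) * of_bool (zs i = z))" for z
  proof -
    \<comment> \<open>With \<open>S = {}\<close> nothing is conditioned on, so any message tuple
      will do.\<close>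
    have "letter {} undefined i z = (\<Sum>zs\<in>words N. p zs * of_bool (zs i = z))"
      using cond_marginal[OF i, of "{}" undefined "\<lambda>y. of_bool (y = z)"]
      by (simp add: cond_def marg_empty code_output_def sum.delta')
    moreover have "q z = (\<Sum>zs\<in>words N. (\<Prod>i<N. q (zs i)) * of_bool (zs i = z))"
      using sum_words_marginal[of N "\<lambda>_. q" i "\<lambda>y. of_bool (y = z)"] q i by (simp add: sum.delta')
    ultimately show ?thesis
      by (simp add: letter_def marg_empty left_diff_distrib sum_subtractf)
  qed
  then have "(\<Sum>z\<in>UNIV. \<bar>expect bits (bern (bias i)) (\<lambda>x. W x z) - q z\<bar>) \<le>
      (\<Sum>z\<in>UNIV. \<Sum>zs\<in>words N. \<bar>(p zs - (\<Prod>i<N. q (zs i))) * of_bool (zs i = z)\<bar>)"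
    by (simp only:) (intro sum_mono sum_abs)
  also have "\<dots> = (\<Sum>zs\<in>words N. \<Sum>z\<in>UNIV. \<bar>p zs - (\<Prod>i<N. q (zs i))\<bar> * of_bool (zs i = z))"
    by (subst sum.swap) (simp add: abs_mult)
  also have "\<dots> = (\<Sum>zs\<in>words N. \<bar>p zs - (\<Prod>i<N. q (zs i))\<bar>)"
    by (simp add: sum.delta flip: sum_distrib_left)
  finally show ?thesis .
qed

end

section \<open>Single-letter quantities and block codes\<close>

text \<open>Independence across times: transposing one word per transmitter into a sequence of input
  tuples turns the sum into a product.\<close>

lemma expect_block:
  fixes r :: "nat \<Rightarrow> 'l::finite \<Rightarrow> bool \<Rightarrow> real"
  shows "expect (\<lambda>_. words N) (\<lambda>l x. \<Prod>i<N. r i l (x i)) (\<lambda>x. \<Prod>i<N. G i (\<lambda>l. x l i)) =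
    (\<Prod>i<N. expect bits (r i) (G i))"
proof -
  have "(\<Prod>i<N. expect bits (r i) (G i)) =
      (\<Sum>y\<in>Pi\<^sub>E {..<N} (\<lambda>_. UNIV). \<Prod>i<N. (\<Prod>l\<in>UNIV. r i l (y i l)) * G i (y i))"
    unfolding expect_def by (subst prod_sum_PiE) auto
  also have "\<dots> = expect (\<lambda>_. words N) (\<lambda>l x. \<Prod>i<N. r i l (x i)) (\<lambda>x. \<Prod>i<N. G i (\<lambda>l. x l i))"
    unfolding expect_def
  proof (rule sum.reindex_bij_witness[where i = "\<lambda>x. \<lambda>i\<in>{..<N}. \<lambda>l. x l i"
        and j = "\<lambda>y l. \<lambda>i\<in>{..<N}. y i l"])
    fix y :: "nat \<Rightarrow> 'l \<Rightarrow> bool" assume "y \<in> Pi\<^sub>E {..<N} (\<lambda>_. UNIV)"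
    show "(\<Prod>l\<in>UNIV. \<Prod>i<N. r i l ((\<lambda>i\<in>{..<N}. y i l) i)) *
        (\<Prod>i<N. G i (\<lambda>l. (\<lambda>i\<in>{..<N}. y i l) i)) =
        (\<Prod>i<N. (\<Prod>l\<in>UNIV. r i l (y i l)) * G i (y i))"
      by (subst prod.swap) (simp add: prod.distrib)
  qed (auto simp: PiE_iff extensional_def fun_eq_iff)
  finally show ?thesis ..
qed

section \<open>Information and Renyi moments at a feasible bias\<close>

definition feasible ::
  "(('l::finite \<Rightarrow> bool) \<Rightarrow> 'z::finite \<Rightarrow> real) \<Rightarrow> ('z \<Rightarrow> real) \<Rightarrow> (real ^ 'l) set" where
  "feasible W qZ = {a. (\<forall>l. 0 \<le> a $ l \<and> a $ l \<le> 1) \<and> (\<forall>z. expect bits (bern a) (\<lambda>x. W x z) = qZ z)}"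

text \<open>On \<open>feasible\<close> these are mutual informations in bits. Elsewhere the fixed
  entropy of \<open>qZ\<close> matches the converse bound, which must cover biases that only nearly
  induce \<open>qZ\<close>.\<close>

definition info ::
  "(('l::finite \<Rightarrow> bool) \<Rightarrow> 'z::finite \<Rightarrow> real) \<Rightarrow> ('z \<Rightarrow> real) \<Rightarrow> real ^ 'l \<Rightarrow> real ^ ('l set)" where
  "info W qZ a = (\<chi> S. (neg_entropy W a S - (\<Sum>z\<in>UNIV. xlnx (qZ z))) / ln 2)"

definition renyi ::
  "(('l::finite \<Rightarrow> bool) \<Rightarrow> 'z::finite \<Rightarrow> real) \<Rightarrow> ('z \<Rightarrow> real) \<Rightarrow> real ^ 'l \<Rightarrow> 'l set \<Rightarrow> real \<Rightarrow> real" where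
  "renyi W qZ a S \<rho> = expect bits (bern a) (\<lambda>x. \<Sum>z\<in>UNIV.
    marg bits (bern a) W S x z * (marg bits (bern a) W S x z / qZ z) powr \<rho>)"

lemma pmfs_bern: "(\<And>l. 0 \<le> a $ l \<and> a $ l \<le> 1) \<Longrightarrow> pmfs bits (bern a)"
  by (auto simp: pmfs_def pmf_on_def bern_def UNIV_bool)

locale letter =
  fixes W :: "('l::finite \<Rightarrow> bool) \<Rightarrow> 'z::finite \<Rightarrow> real" and qZ :: "'z \<Rightarrow> real" and a :: "real ^ 'l"
  assumes W: "channel W" and a: "a \<in> feasible W qZ"
begin

abbreviation "EB \<equiv> expect bits (bern a)"
abbreviation "m \<equiv> marg bits (bern a) W"

lemma pm: "pmfs bits (bern a)"
  using a by (intro pmfs_bern) (auto simp: feasible_def)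

lemma m0: "0 \<le> m S x z"
  by (intro marg_nonneg pm channel_nonneg W)

lemma expect_m: "EB (\<lambda>x. m S x z) = qZ z"
  using a by (simp add: expect_marg[OF pm] feasible_def)

lemma qZ_nonneg: "0 \<le> qZ z"
  unfolding expect_m[symmetric, of _ "{}"] by (intro expect_nonneg pm m0)

lemma m_sum: "(\<Sum>z\<in>UNIV. m S x z) = 1"
  unfolding marg_def expect_sum[symmetric] by (simp add: channel_sum W expect_const[OF pm])

lemma qZ_sum: "(\<Sum>z\<in>UNIV. qZ z) = 1"
  unfolding expect_m[symmetric, of _ "{}"] expect_sum[symmetric] by (simp add: m_sum expect_const[OF pm])

text \<open>Keeps one term of the mean \<open>qZ z\<close>. Hence inputs of positive weight produce
  no output outside the support of \<open>qZ\<close>.\<close>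

lemma m_le: "(\<Prod>l\<in>UNIV. bern a l (x l)) * m S x z \<le> qZ z"
proof -
  have "(\<Prod>l\<in>UNIV. bern a l (x l)) * m S x z \<le>
      (\<Sum>x\<in>Pi\<^sub>E UNIV bits. (\<Prod>l\<in>UNIV. bern a l (x l)) * m S x z)"
    by (rule member_le_sum[of x]) (auto intro!: mult_nonneg_nonneg m0 weight_nonneg[OF pm])
  then show ?thesis using expect_m[of S z] by (simp add: expect_def)
qed

text \<open>Pairs \<open>(x, z)\<close> with \<open>qZ z = 0 < m S x z\<close> have weight zero, so the junk values of the
  logarithm and of the quotient there are harmless.\<close>

lemma expect_absolutely_continuous:
  assumes "\<And>x z. 0 < qZ z \<or> m S x z = 0 \<Longrightarrow> F x z = G x z"
    and "\<And>x z. m S x z * F' x z = F x z" and "\<And>x z. m S x z * G' x z = G x z"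
  shows "EB (\<lambda>x. \<Sum>z\<in>UNIV. F x z) = EB (\<lambda>x. \<Sum>z\<in>UNIV. G x z)"
proof -
  have "(\<Prod>l\<in>UNIV. bern a l (x l)) * F x z = (\<Prod>l\<in>UNIV. bern a l (x l)) * G x z" for x z
  proof (cases "0 < qZ z \<or> m S x z = 0")
    case False
    then have "qZ z = 0" using qZ_nonneg[of z] by linarith
    then have "(\<Prod>l\<in>UNIV. bern a l (x l)) * m S x z = 0"
      using m_le[of x S z] m0[of S x z] weight_nonneg[OF pm, of x]
      by (intro antisym mult_nonneg_nonneg) auto
    then show ?thesis
      unfolding assms(2,3)[symmetric] mult.assoc[symmetric] by (simp only: mult_zero_left)
  qed (simp add: assms(1))
  then show ?thesis unfolding expect_def sum_distrib_left by (simp only:)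
qed

text \<open>Since \<open>0 powr 0 = 0\<close>, only the mass where the quotient is nonzero is
  counted; absolute continuity makes this the full mass.\<close>

lemma renyi_0: "renyi W qZ a S 0 = 1"
proof -
  have "renyi W qZ a S 0 = EB (\<lambda>x. \<Sum>z\<in>UNIV. m S x z)"
    unfolding renyi_def
    by (rule expect_absolutely_continuous[where S = S and F' = "\<lambda>x z. (m S x z / qZ z) powr 0" and G' = "\<lambda>_ _. 1"])
      auto
  then show ?thesis by (simp add: m_sum expect_const[OF pm])
qed

lemma info_eq: "info W qZ a $ S * ln 2 = EB (\<lambda>x. \<Sum>z\<in>UNIV. m S x z * ln (m S x z / qZ z))"
proof -
  \<comment> \<open>The mean of \<open>m S x z\<close> is \<open>qZ z\<close>, so the entropy of
    \<open>qZ\<close> can be moved under the expectation.\<close>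
  have "(\<Sum>z\<in>UNIV. xlnx (qZ z)) = EB (\<lambda>x. \<Sum>z\<in>UNIV. m S x z * ln (qZ z))"
    unfolding expect_sum expect_multc expect_m xlnx_def ..
  then have "info W qZ a $ S * ln 2 =
      EB (\<lambda>x. \<Sum>z\<in>UNIV. m S x z * (ln (m S x z) - ln (qZ z)))"
    unfolding info_def neg_entropy_def
    by (simp add: right_diff_distrib sum_subtractf expect_diff xlnx_def)
  also have "\<dots> = EB (\<lambda>x. \<Sum>z\<in>UNIV. m S x z * ln (m S x z / qZ z))"
  proof (rule expect_absolutely_continuous[where S = S and F' = "\<lambda>x z. ln (m S x z) - ln (qZ z)"
        and G' = "\<lambda>x z. ln (m S x z / qZ z)"])
    show "m S x z * (ln (m S x z) - ln (qZ z)) = m S x z * ln (m S x z / qZ z)"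
      if "0 < qZ z \<or> m S x z = 0" for x z
      using that m0[of S x z] by (cases "m S x z = 0") (auto simp: ln_div)
  qed auto
  finally show ?thesis .
qed

lemma info_empty: "info W qZ a $ {} = 0"
  using a by (simp add: info_def neg_entropy_def marg_empty feasible_def expect_const[OF pm])

text \<open>Gibbs' inequality, applied at inputs of positive weight, where \<open>qZ\<close> is
  positive on the support of the conditional law.\<close>

lemma info_nonneg: "0 \<le> info W qZ a $ S"
proof -
  have "0 = EB (\<lambda>x. \<Sum>z\<in>UNIV. m S x z - qZ z)"
    by (simp add: sum_subtractf m_sum qZ_sum expect_const[OF pm])
  also have "\<dots> \<le> EB (\<lambda>x. \<Sum>z\<in>UNIV. m S x z * ln (m S x z / qZ z))"
    unfolding expect_def
  proof (intro sum_mono)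
    fix x
    let ?w = "\<Prod>l\<in>UNIV. bern a l (x l)"
    have w: "0 \<le> ?w" by (rule weight_nonneg[OF pm]) simp
    show "?w * (\<Sum>z\<in>UNIV. m S x z - qZ z) \<le> ?w * (\<Sum>z\<in>UNIV. m S x z * ln (m S x z / qZ z))"
    proof (cases "?w = 0")
      case False
      have "m S x z - qZ z \<le> m S x z * ln (m S x z / qZ z)" for z
      proof (cases "m S x z = 0")
        case True
        then show ?thesis using qZ_nonneg by simp
      next
        case m: False
        then have mp: "0 < m S x z" using m0[of S x z] by linarith
        then have qp: "0 < qZ z"
          using m_le[of x S z] False w by (smt (verit) mult_pos_pos)
        show ?thesis
          using gibbs_pointwise[of "m S x z" "qZ z"] mp qp
          by (simp add: xlnx_def ln_div right_diff_distrib)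
      qed
      then show ?thesis by (intro mult_left_mono sum_mono w)
    qed (simp only: mult_zero_left)
  qed
  finally show ?thesis by (simp add: info_eq[symmetric] zero_le_mult_iff)
qed

lemma renyi_nonneg: "0 \<le> renyi W qZ a S \<rho>"
  unfolding renyi_def by (intro expect_nonneg pm sum_nonneg mult_nonneg_nonneg m0) auto

lemma renyi_deriv: "((\<lambda>\<rho>. renyi W qZ a S \<rho>) has_real_derivative info W qZ a $ S * ln 2) (at 0)"
  unfolding info_eq renyi_def expect_def
proof (intro DERIV_sum DERIV_cmult)
  fix x z
  \<comment> \<open>At \<open>y = 0\<close> the power is constantly 0 and \<open>ln 0 = 0\<close>,
    so the formula survives.\<close>
  have "((\<lambda>\<rho>. y powr \<rho>) has_real_derivative ln y) (at 0)" if "0 \<le> y" for y :: real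
  proof (cases "y = 0")
    case False
    then show ?thesis using that by (auto intro!: derivative_eq_intros)
  qed simp
  then show "((\<lambda>\<rho>. (m S x z / qZ z) powr \<rho>) has_real_derivative ln (m S x z / qZ z)) (at 0)"
    using m0[of S x z] qZ_nonneg[of z] by simp
qed

end

text \<open>One-shot soft covering with words as letters, the input law at time \<open>i\<close>
  being given by the bias \<open>a i\<close>; all moments factorise over time.\<close>

lemma exists_code:
  fixes W :: "('l::finite \<Rightarrow> bool) \<Rightarrow> 'z::finite \<Rightarrow> real" and I :: "'l \<Rightarrow> 'm set"
  assumes W: "channel W" and a: "\<And>i. i < N \<Longrightarrow> a i \<in> feasible W qZ"
    and I: "\<And>l. finite (I l)" "\<And>l. I l \<noteq> {}" and rho: "0 < \<rho>" "\<rho> \<le> 1"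
  shows "\<exists>f. (\<Sum>zs\<in>words N. \<bar>code_output I (block W N) f zs - (\<Prod>i<N. qZ (zs i))\<bar>)\<^sup>2 \<le>
    4 * (\<Sum>S\<in>UNIV - {{}}. (\<Prod>l\<in>S. 1 / real (card (I l))) powr \<rho> / \<rho> * (\<Prod>i<N. renyi W qZ (a i) S \<rho>))"
proof -
  define A where "A = (\<lambda>_::'l. words N :: (nat \<Rightarrow> bool) set)"
  define r where "r = (\<lambda>l x. \<Prod>i<N. bern (a i) l (x i))"
  have loc: "letter W qZ (a i)" if "i < N" for i
    using W a[OF that] by unfold_locales
  have pmA: "pmfs A r"
    unfolding pmfs_def pmf_on_def A_def r_def
  proof (intro allI conjI ballI finite_words)
    fix l
    show "0 \<le> (\<Prod>i<N. bern (a i) l (x i))" for x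
      by (intro prod_nonneg) (auto intro!: pmfs_nonneg[OF letter.pm[OF loc]])
    show "(\<Sum>x\<in>words N. \<Prod>i<N. bern (a i) l (x i)) = 1"
      unfolding sum_words_prod[where r = "\<lambda>i. bern (a i) l"]
      by (intro prod.neutral) (auto intro!: pmfs_sum[OF letter.pm[OF loc]])
  qed
  interpret soft_cover A r "block W N" I \<rho>
    using pmA block_nonneg[OF W] I rho by unfold_locales
  have margN: "marg A r (block W N) S x zs =
      (\<Prod>i<N. marg bits (bern (a i)) W S (\<lambda>l. x l i) (zs i))" for S x zs
  proof -
    have "(\<lambda>l. mix S x y l i) = mix S (\<lambda>l. x l i) (\<lambda>l. y l i)" for i and y :: "'l \<Rightarrow> nat \<Rightarrow> bool"
      by (auto simp: mix_def)
    then show ?thesis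
      unfolding marg_def block_def A_def r_def
      by (simp only:) (rule expect_block[where G = "\<lambda>i y. W (mix S (\<lambda>l. x l i) y) (zs i)"])
  qed
  have QN: "expect A r (\<lambda>x. block W N x zs) = (\<Prod>i<N. qZ (zs i))" for zs
  proof -
    have "expect A r (\<lambda>x. block W N x zs) = marg A r (block W N) {} undefined zs"
      by (rule marg_empty[symmetric])
    also have "\<dots> = (\<Prod>i<N. qZ (zs i))"
      unfolding margN using a by (intro prod.cong) (auto simp: marg_empty feasible_def)
    finally show ?thesis .
  qed
  have bound: "(\<Sum>zs\<in>words N. cover_bound S zs) =
      (\<Prod>l\<in>S. 1 / real (card (I l))) powr \<rho> / \<rho> * (\<Prod>i<N. renyi W qZ (a i) S \<rho>)" for S
  proof -
    let ?g = "\<lambda>i x z. marg bits (bern (a i)) W S x z * (marg bits (bern (a i)) W S x z / qZ z) powr \<rho>"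
    have "(\<Sum>zs\<in>words N. cover_bound S zs) = (\<Prod>l\<in>S. 1 / real (card (I l))) powr \<rho> / \<rho> *
        expect A r (\<lambda>x. \<Sum>zs\<in>words N. \<Prod>i<N. ?g i (\<lambda>l. x l i) (zs i))"
      unfolding cover_bound_def expect_sum sum_distrib_left[symmetric] margN QN prod_dividef[symmetric] prod.distrib
    proof (intro arg_cong2[where f = "(*)"] refl sum.cong expect_cong)
      fix zs :: "nat \<Rightarrow> 'z" and x :: "'l \<Rightarrow> nat \<Rightarrow> bool"
      show "(\<Prod>i<N. marg bits (bern (a i)) W S (\<lambda>l. x l i) (zs i) / qZ (zs i)) powr \<rho> =
        (\<Prod>i<N. (marg bits (bern (a i)) W S (\<lambda>l. x l i) (zs i) / qZ (zs i)) powr \<rho>)"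
        by (rule prod_powr_distrib)
    qed
    also have "(\<lambda>x. \<Sum>zs\<in>words N. \<Prod>i<N. ?g i (\<lambda>l. x l i) (zs i)) =
        (\<lambda>x. \<Prod>i<N. \<Sum>z\<in>UNIV. ?g i (\<lambda>l. x l i) z)"
      by (intro ext sum_words_prod)
    also have "expect A r \<dots> = (\<Prod>i<N. renyi W qZ (a i) S \<rho>)"
      unfolding A_def r_def renyi_def by (rule expect_block[where G = "\<lambda>i x. \<Sum>z\<in>UNIV. ?g i x z"])
    finally show ?thesis .
  qed
  show ?thesis
    using exists_soft_covering[of "words N"] block_sum[OF W] unfolding QN bound by blast
qed

section \<open>Achievability\<close>

text \<open>For an i.i.d. time-sharing word each product averages to an \<open>N\<close>-th power.
  Bounding the whole weighted sum lets one word serve all subsets at once.\<close>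

lemma exists_time_sharing:
  fixes \<phi> :: "'t \<Rightarrow> 's \<Rightarrow> real"
  assumes T: "finite T" and u: "\<And>j. j \<in> T \<Longrightarrow> 0 \<le> u j" "sum u T = 1"
  shows "\<exists>t\<in>Pi\<^sub>E {..<N} (\<lambda>_. T). (\<Sum>S\<in>\<S>. c S * (\<Prod>i<N. \<phi> (t i) S)) \<le>
    (\<Sum>S\<in>\<S>. c S * (\<Sum>j\<in>T. u j * \<phi> j S) ^ N)"
proof (rule exists_le_weighted_mean[where w = "\<lambda>t. \<Prod>i<N. u (t i)"])
  have ps: "(\<Sum>t\<in>Pi\<^sub>E {..<N} (\<lambda>_. T). \<Prod>i<N. g (t i)) = (\<Sum>j\<in>T. g j) ^ N" for g :: "'t \<Rightarrow> real"
    using prod_sum_PiE[of "{..<N}" "\<lambda>_. T" "\<lambda>_. g"] T by simp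
  show "(\<Sum>t\<in>Pi\<^sub>E {..<N} (\<lambda>_. T). \<Prod>i<N. u (t i)) = 1"
    using ps[of u] u by simp
  have "(\<Sum>t\<in>Pi\<^sub>E {..<N} (\<lambda>_. T). (\<Prod>i<N. u (t i)) * (\<Sum>S\<in>\<S>. c S * (\<Prod>i<N. \<phi> (t i) S))) =
      (\<Sum>S\<in>\<S>. \<Sum>t\<in>Pi\<^sub>E {..<N} (\<lambda>_. T). c S * (\<Prod>i<N. u (t i) * \<phi> (t i) S))"
    unfolding sum_distrib_left by (subst sum.swap) (simp add: prod.distrib mult_ac)
  also have "\<dots> = (\<Sum>S\<in>\<S>. c S * (\<Sum>j\<in>T. u j * \<phi> j S) ^ N)"
  proof (intro sum.cong refl)
    fix S
    show "(\<Sum>t\<in>Pi\<^sub>E {..<N} (\<lambda>_. T). c S * (\<Prod>i<N. u (t i) * \<phi> (t i) S)) =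
        c S * (\<Sum>j\<in>T. u j * \<phi> j S) ^ N"
      unfolding sum_distrib_left[symmetric] ps[of "\<lambda>j. u j * \<phi> j S"] ..
  qed
  finally show "(\<Sum>t\<in>Pi\<^sub>E {..<N} (\<lambda>_. T). (\<Prod>i<N. u (t i)) * (\<Sum>S\<in>\<S>. c S * (\<Prod>i<N. \<phi> (t i) S))) \<le>
      (\<Sum>S\<in>\<S>. c S * (\<Sum>j\<in>T. u j * \<phi> j S) ^ N)" by simp
qed (auto intro!: prod_nonneg u)

section \<open>Sizes of the message sets\<close>

lemma induced_dist_eq:
  "induced_dist W R N f = code_output (\<lambda>l. {1..msg_size N (R $ l)}) (block W N) f"
  by (rule ext) (simp add: induced_dist_def code_output_def expect_def uniform_def block_def)

text \<open>Rounding down a number that is at least 1 costs at most a factor 2.\<close>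

lemma inverse_msg_size_le:
  assumes "0 \<le> r"
  shows "1 \<le> msg_size N r" "1 / real (msg_size N r) \<le> 2 * 2 powr (- (real N * r))"
proof -
  define y where "y = 2 powr (real N * r)"
  have y: "1 \<le> y" unfolding y_def using assms by (intro ge_one_powr_ge_zero) auto
  then have f1: "1 \<le> \<lfloor>y\<rfloor>" by simp
  then show "1 \<le> msg_size N r" unfolding msg_size_def y_def[symmetric] by linarith
  have "y < real_of_int \<lfloor>y\<rfloor> + 1" by linarith
  then have "y \<le> 2 * real_of_int \<lfloor>y\<rfloor>" using f1 by linarith
  moreover have "real (msg_size N r) = real_of_int \<lfloor>y\<rfloor>"
    unfolding msg_size_def y_def[symmetric] using f1 by simp
  ultimately have le: "y \<le> 2 * real (msg_size N r)" by simp
  moreover have "0 < real (msg_size N r)" using \<open>1 \<le> msg_size N r\<close> by simp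
  ultimately have "1 / real (msg_size N r) \<le> 2 / y" using y by (simp add: field_simps)
  then show "1 / real (msg_size N r) \<le> 2 * 2 powr (- (real N * r))"
    unfolding y_def powr_minus by (simp add: divide_inverse)
qed

lemma inverse_msg_sizes_powr_le:
  fixes R :: "real ^ 'l::finite"
  assumes R: "\<And>l. 0 \<le> R $ l" and rho: "0 < \<rho>"
  shows "(\<Prod>l\<in>S. 1 / real (msg_size N (R $ l))) powr \<rho> \<le>
    (2 ^ card S) powr \<rho> * (2 powr (- (\<rho> * (\<Sum>l\<in>S. R $ l)))) ^ N"
proof -
  have "(\<Prod>l\<in>S. 1 / real (msg_size N (R $ l))) \<le> (\<Prod>l\<in>S. 2 * 2 powr (- (real N * R $ l)))"
    by (intro prod_mono conjI inverse_msg_size_le R) auto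
  also have "\<dots> = 2 ^ card S * 2 powr (\<Sum>l\<in>S. - (real N * R $ l))"
    by (simp add: prod.distrib powr_sum)
  also have "(\<Sum>l\<in>S. - (real N * R $ l)) = - (real N * (\<Sum>l\<in>S. R $ l))"
    by (simp add: sum_negf sum_distrib_left)
  finally have "(\<Prod>l\<in>S. 1 / real (msg_size N (R $ l))) powr \<rho> \<le>
      (2 ^ card S * 2 powr (- (real N * (\<Sum>l\<in>S. R $ l)))) powr \<rho>"
    using rho by (intro powr_mono2 prod_nonneg) auto
  also have "\<dots> = (2 ^ card S) powr \<rho> * (2 powr (- (\<rho> * (\<Sum>l\<in>S. R $ l)))) ^ N"
    by (simp add: powr_mult powr_powr powr_realpow[symmetric] mult_ac)
  finally show ?thesis .
qed

theorem achievable_if_above_hull: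
  fixes W :: "('l::finite \<Rightarrow> bool) \<Rightarrow> 'z::finite \<Rightarrow> real"
  assumes W: "channel W" and v: "v \<in> convex hull (info W qZ ` feasible W qZ)"
    and R: "\<And>S. S \<noteq> {} \<Longrightarrow> v $ S < (\<Sum>l\<in>S. R $ l)"
  shows "achievable W qZ R"
proof -
  obtain T u where T: "finite T" "T \<subseteq> info W qZ ` feasible W qZ" "\<And>j. j \<in> T \<Longrightarrow> 0 \<le> u j" "sum u T = 1"
    and v_eq: "v = (\<Sum>j\<in>T. u j *\<^sub>R j)"
    using v unfolding convex_hull_explicit by blast
  have "\<forall>j\<in>T. \<exists>a. a \<in> feasible W qZ \<and> info W qZ a = j" using T(2) by blast
  then obtain b where b: "\<And>j. j \<in> T \<Longrightarrow> b j \<in> feasible W qZ" "\<And>j. j \<in> T \<Longrightarrow> info W qZ (b j) = j"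
    by metis
  have loc: "letter W qZ (b j)" if "j \<in> T" for j using W b(1)[OF that] by unfold_locales
  have v_nth: "v $ S = (\<Sum>j\<in>T. u j * j $ S)" for S by (simp add: v_eq)
  have v0: "0 \<le> v $ S" for S
    unfolding v_nth using letter.info_nonneg[OF loc] b(2) T(3)
    by (intro sum_nonneg mult_nonneg_nonneg) auto
  \<comment> \<open>Singletons force nonnegative rates, so no message set is empty.\<close>
  have Rl: "0 \<le> R $ l" for l using R[of "{l}"] v0[of "{l}"] by simp
  define G where "G S \<rho> = (\<Sum>j\<in>T. u j * renyi W qZ (b j) S \<rho>)" for S \<rho>
  \<comment> \<open>The base of the exponential decay: \<open>H S 0 = 1\<close>, and for nonempty
    \<open>S\<close> the slope at 0 is negative, so small \<open>\<rho>\<close> give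
    \<open>H S \<rho> < 1\<close>.\<close>
  define H where "H S \<rho> = 2 powr (- (\<rho> * (\<Sum>l\<in>S. R $ l))) * G S \<rho>" for S \<rho>
  have G0: "G S 0 = 1" for S
    unfolding G_def using T(4) by (simp add: letter.renyi_0[OF loc])
  have G_nonneg: "0 \<le> G S \<rho>" for S \<rho>
    unfolding G_def by (intro sum_nonneg mult_nonneg_nonneg T letter.renyi_nonneg[OF loc])
  have G': "(G S has_real_derivative v $ S * ln 2) (at 0)" for S
  proof -
    have "(G S has_real_derivative (\<Sum>j\<in>T. u j * (info W qZ (b j) $ S * ln 2))) (at 0)"
      unfolding G_def by (intro DERIV_sum DERIV_cmult letter.renyi_deriv[OF loc])
    then show ?thesis by (simp add: v_nth b(2) sum_distrib_right mult.assoc)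
  qed
  have "(H S has_real_derivative (v $ S - (\<Sum>l\<in>S. R $ l)) * ln 2) (at 0)" for S
  proof -
    have "((\<lambda>\<rho>. 2 powr (- (\<rho> * r))) has_real_derivative - (r * ln 2)) (at 0)" for r :: real
      by (auto intro!: derivative_eq_intros)
    from DERIV_mult[OF this G', of "\<Sum>l\<in>S. R $ l"]
    show ?thesis unfolding H_def by (simp add: G0 left_diff_distrib)
  qed
  then have dec: "\<exists>d>0. \<forall>h>0. h < d \<longrightarrow> H S (0 + h) < H S 0" if "S \<noteq> {}" for S
    using R[OF that] by (intro DERIV_neg_dec_right) (auto simp: mult_neg_pos)
  have "\<forall>\<^sub>F \<rho> in at_right 0. H S \<rho> < 1" if S: "S \<noteq> {}" for S
  proof -
    obtain d where d: "0 < d" "\<And>h. 0 < h \<Longrightarrow> h < d \<Longrightarrow> H S (0 + h) < H S 0"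
      using dec[OF S] by blast
    have "H S 0 = 1" by (simp add: H_def G0)
    with d show ?thesis unfolding eventually_at_right_field by (intro exI[of _ d]) simp
  qed
  \<comment> \<open>There are finitely many \<open>S\<close>, so a common \<open>\<rho>\<close>
    exists.\<close>
  then have "\<forall>\<^sub>F \<rho> in at_right 0. \<forall>S\<in>UNIV - {{}}. H S \<rho> < 1"
    by (intro eventually_ball_finite) auto
  moreover have "\<forall>\<^sub>F \<rho> in at_right 0. 0 < \<rho> \<and> \<rho> \<le> (1::real)"
    unfolding eventually_at_right_field by (rule exI[of _ 1]) auto
  ultimately have "\<forall>\<^sub>F \<rho> in at_right 0. (\<forall>S\<in>UNIV - {{}}. H S \<rho> < 1) \<and> 0 < \<rho> \<and> \<rho> \<le> 1"
    by (rule eventually_conj)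
  from eventually_happens[OF this] obtain \<rho>
    where H: "\<And>S. S \<noteq> {} \<Longrightarrow> H S \<rho> < 1" and rho: "0 < \<rho>" "\<rho> \<le> 1"
    by auto
  \<comment> \<open>The factor \<open>(2 ^ card S) powr \<rho>\<close> pays for rounding the message
    set sizes.\<close>
  define bnd where "bnd N = 4 * (\<Sum>S\<in>UNIV - {{}}. (2 ^ card S) powr \<rho> / \<rho> * H S \<rho> ^ N)" for N
  have "\<exists>f. (var_dist_N N (induced_dist W R N f) (\<lambda>zs. \<Prod>i<N. qZ (zs i)))\<^sup>2 \<le> bnd N" for N
  proof -
    let ?I = "\<lambda>l. {1..msg_size N (R $ l)}"
    have I: "finite (?I l)" "?I l \<noteq> {}" for l
      using inverse_msg_size_le(1)[OF Rl[of l], of N] by auto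
    obtain t where t: "t \<in> Pi\<^sub>E {..<N} (\<lambda>_. T)"
      "(\<Sum>S\<in>UNIV - {{}}. (\<Prod>l\<in>S. 1 / real (card (?I l))) powr \<rho> / \<rho> * (\<Prod>i<N. renyi W qZ (b (t i)) S \<rho>)) \<le>
       (\<Sum>S\<in>UNIV - {{}}. (\<Prod>l\<in>S. 1 / real (card (?I l))) powr \<rho> / \<rho> * G S \<rho> ^ N)"
      using exists_time_sharing[OF T(1,3,4), where \<phi> = "\<lambda>j S. renyi W qZ (b j) S \<rho>"
          and c = "\<lambda>S. (\<Prod>l\<in>S. 1 / real (card (?I l))) powr \<rho> / \<rho>"]
      unfolding G_def by blast
    have bt: "b (t i) \<in> feasible W qZ" if "i < N" for i
      using t(1) that by (intro b) auto
    obtain f where f: "(\<Sum>zs\<in>words N. \<bar>code_output ?I (block W N) f zs - (\<Prod>i<N. qZ (zs i))\<bar>)\<^sup>2 \<le>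
      4 * (\<Sum>S\<in>UNIV - {{}}. (\<Prod>l\<in>S. 1 / real (card (?I l))) powr \<rho> / \<rho> * (\<Prod>i<N. renyi W qZ (b (t i)) S \<rho>))"
      using exists_code[where N = N and a = "\<lambda>i. b (t i)" and I = ?I, OF W bt I rho] by blast
    have "(\<Sum>S\<in>UNIV - {{}}. (\<Prod>l\<in>S. 1 / real (card (?I l))) powr \<rho> / \<rho> * G S \<rho> ^ N) \<le>
        (\<Sum>S\<in>UNIV - {{}}. (2 ^ card S) powr \<rho> / \<rho> * H S \<rho> ^ N)"
    proof (rule sum_mono)
      fix S
      have "(\<Prod>l\<in>S. 1 / real (card (?I l))) powr \<rho> / \<rho> * G S \<rho> ^ N \<le>
          (2 ^ card S) powr \<rho> * (2 powr (- (\<rho> * (\<Sum>l\<in>S. R $ l)))) ^ N / \<rho> * G S \<rho> ^ N"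
        using inverse_msg_sizes_powr_le[OF Rl rho(1), where S = S and N = N] rho
        by (intro mult_right_mono divide_right_mono zero_le_power G_nonneg) auto
      then show "(\<Prod>l\<in>S. 1 / real (card (?I l))) powr \<rho> / \<rho> * G S \<rho> ^ N \<le>
          (2 ^ card S) powr \<rho> / \<rho> * H S \<rho> ^ N"
        by (simp add: H_def power_mult_distrib)
    qed
    then show ?thesis
      using f t(2) unfolding var_dist_N_def induced_dist_eq bnd_def by (intro exI[of _ f]) linarith
  qed
  then obtain f where f: "\<And>N. (var_dist_N N (induced_dist W R N (f N)) (\<lambda>zs. \<Prod>i<N. qZ (zs i)))\<^sup>2 \<le> bnd N"
    by metis
  have "bnd \<longlonglongrightarrow> 4 * (\<Sum>S\<in>UNIV - {{} :: 'l set}. (2 ^ card S) powr \<rho> / \<rho> * 0)"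
    unfolding bnd_def
  proof (intro tendsto_mult tendsto_const tendsto_sum LIMSEQ_power_zero)
    fix S :: "'l set" assume "S \<in> UNIV - {{}}"
    moreover have "0 \<le> H S \<rho>" unfolding H_def by (intro mult_nonneg_nonneg G_nonneg) auto
    ultimately show "norm (H S \<rho>) < 1" using H[of S] by simp
  qed
  then have "(\<lambda>N. sqrt (bnd N)) \<longlonglongrightarrow> 0"
    using tendsto_real_sqrt[of bnd 0] by simp
  then have "(\<lambda>N. var_dist_N N (induced_dist W R N (f N)) (\<lambda>zs. \<Prod>i<N. qZ (zs i))) \<longlonglongrightarrow> 0"
  proof (rule Lim_null_comparison[rotated])
    show "\<forall>\<^sub>F N in sequentially. norm (var_dist_N N (induced_dist W R N (f N)) (\<lambda>zs. \<Prod>i<N. qZ (zs i))) \<le> sqrt (bnd N)"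
    proof (intro always_eventually allI)
      fix N
      show "norm (var_dist_N N (induced_dist W R N (f N)) (\<lambda>zs. \<Prod>i<N. qZ (zs i))) \<le> sqrt (bnd N)"
        using real_le_rsqrt[OF f[of N]] by (simp add: var_dist_N_def sum_nonneg)
    qed
  qed
  then show ?thesis unfolding achievable_def by blast
qed

section \<open>The single-letter region as a convex hull\<close>

definition hull_region ::
  "(('l::finite \<Rightarrow> bool) \<Rightarrow> 'z::finite \<Rightarrow> real) \<Rightarrow> ('z \<Rightarrow> real) \<Rightarrow> (real ^ 'l) set" where
  "hull_region W qZ =
    {R. \<exists>v \<in> convex hull (info W qZ ` feasible W qZ). \<forall>S. v $ S \<le> (\<Sum>l\<in>S. R $ l)}"

text \<open>The probability of agreeing with \<open>x\<close> on \<open>S\<close> times a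
  conditional mean: after resampling outside \<open>S\<close> the two factors separate.\<close>

lemma sum_agree_eq:
  fixes x :: "'l::finite \<Rightarrow> bool"
  assumes p: "pmfs bits q"
  shows "(\<Sum>x'\<in>{x'. \<forall>l\<in>S. x' l = x l}. (\<Prod>l\<in>UNIV. q l (x' l)) * F x') =
    (\<Prod>l\<in>S. q l (x l)) * expect bits q (\<lambda>y. F (mix S x y))"
proof -
  let ?agree = "\<lambda>y. (\<Prod>l\<in>S. of_bool (x l = y l)) :: real"
  have ag: "?agree y = of_bool (\<forall>l\<in>S. y l = x l)" for y
  proof (cases "\<forall>l\<in>S. y l = x l")
    case False
    then have "?agree y = 0" by (intro prod_zero) auto
    then show ?thesis using False by simp
  qed simp
  have "(\<Sum>x'\<in>{x'. \<forall>l\<in>S. x' l = x l}. (\<Prod>l\<in>UNIV. q l (x' l)) * F x') =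
      expect bits q (\<lambda>y. ?agree y * F y)"
    unfolding expect_def ag by (rule sum.mono_neutral_cong_left) auto
  also have "\<dots> = expect bits q (\<lambda>u. expect bits q (\<lambda>y. ?agree (mix S u y) * F (mix S u y)))"
    by (rule expect_mix[OF p, symmetric])
  also have "\<dots> = expect bits q (\<lambda>u. ?agree u * expect bits q (\<lambda>y. F (mix S x y)))"
  proof (intro expect_cong)
    fix u
    have "?agree (mix S u y) * F (mix S u y) = ?agree u * F (mix S x y)" for y
    proof (cases "\<forall>l\<in>S. u l = x l")
      case True
      then have "mix S u y = mix S x y" by (auto simp: mix_def fun_eq_iff)
      then show ?thesis using True by (simp add: ag) (simp add: mix_def)
    next
      case False
      then have "\<not> (\<forall>l\<in>S. mix S u y l = x l)" by (simp add: mix_def)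
      then show ?thesis using False by (simp only: ag) simp
    qed
    then show "expect bits q (\<lambda>y. ?agree (mix S u y) * F (mix S u y)) =
        ?agree u * expect bits q (\<lambda>y. F (mix S x y))"
      by (simp only: expect_cmult)
  qed
  also have "\<dots> = (\<Prod>l\<in>S. q l (x l)) * expect bits q (\<lambda>y. F (mix S x y))"
    unfolding expect_multc by (subst expect_agree[OF p]) auto
  finally show ?thesis .
qed

section \<open>Conditional mutual information in terms of \<open>info\<close>\<close>

context letter
begin

text \<open>The logarithm depends on \<open>x\<close> only through \<open>S\<close>, so outside it
  \<open>W\<close> may stand for its average \<open>m\<close>, as in \<open>cond_MI\<close>.\<close>

lemma info_eq_log:
  "info W qZ a $ S = (\<Sum>x\<in>UNIV. \<Sum>z\<in>UNIV. (\<Prod>l\<in>UNIV. bern a l (x l)) * W x z * log 2 (m S x z / qZ z))"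
proof -
  have "(\<Sum>x\<in>UNIV. \<Sum>z\<in>UNIV. (\<Prod>l\<in>UNIV. bern a l (x l)) * W x z * log 2 (m S x z / qZ z)) =
      (\<Sum>z\<in>UNIV. EB (\<lambda>x. W x z * log 2 (m S x z / qZ z)))"
    unfolding expect_def by (subst sum.swap) (simp add: mult.assoc)
  also have "\<dots> = (\<Sum>z\<in>UNIV. EB (\<lambda>x. m S x z * log 2 (m S x z / qZ z)))"
    by (intro sum.cong refl expect_marg_mult[OF pm]) simp
  also have "\<dots> = EB (\<lambda>x. \<Sum>z\<in>UNIV. m S x z * ln (m S x z / qZ z)) / ln 2"
    unfolding expect_sum[symmetric] by (simp add: expect_def log_def sum_divide_distrib sum_distrib_left)
  also have "\<dots> = info W qZ a $ S" unfolding info_eq[symmetric] by simp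
  finally show ?thesis ..
qed

text \<open>In the quotient \<open>p\<close> and the weight of \<open>x\<close> on \<open>S\<close>
  cancel. If \<open>p\<close> or the weight of \<open>x\<close> vanishes, the summand is 0 in both
  forms.\<close>

lemma cond_MI_summand:
  fixes p :: real
  defines "P \<equiv> \<lambda>x z. p * (\<Prod>l\<in>UNIV. bern a l (x l)) * W x z"
  shows "(\<Sum>x\<in>UNIV. \<Sum>z\<in>UNIV. P x z * log 2
      (((\<Sum>x'\<in>{x'. \<forall>l\<in>S. x' l = x l}. P x' z) * (\<Sum>x'\<in>UNIV. \<Sum>z\<in>UNIV. P x' z)) /
       ((\<Sum>z\<in>UNIV. \<Sum>x'\<in>{x'. \<forall>l\<in>S. x' l = x l}. P x' z) * (\<Sum>x'\<in>UNIV. P x' z)))) =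
    p * info W qZ a $ S"
proof -
  let ?w = "\<lambda>x. \<Prod>l\<in>UNIV. bern a l (x l)"
  let ?wS = "\<lambda>x. \<Prod>l\<in>S. bern a l (x l)"
  have agree: "(\<Sum>x'\<in>{x'. \<forall>l\<in>S. x' l = x l}. P x' z) = p * (?wS x * m S x z)" for x z
    unfolding P_def mult.assoc sum_distrib_left[symmetric] sum_agree_eq[OF pm] marg_def ..
  have agree_sum: "(\<Sum>z\<in>UNIV. p * (?wS x * m S x z)) = p * ?wS x" for x
    by (simp add: m_sum flip: sum_distrib_left)
  have PZ: "(\<Sum>x'\<in>UNIV. P x' z) = p * qZ z" for z
    using a unfolding P_def by (simp add: feasible_def expect_def mult.assoc flip: sum_distrib_left)
  have "(\<Sum>x'\<in>UNIV. \<Sum>z\<in>UNIV. P x' z) = p"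
    by (subst sum.swap) (simp add: PZ qZ_sum flip: sum_distrib_left)
  then have "(\<Sum>x\<in>UNIV. \<Sum>z\<in>UNIV. P x z * log 2
      (((\<Sum>x'\<in>{x'. \<forall>l\<in>S. x' l = x l}. P x' z) * (\<Sum>x'\<in>UNIV. \<Sum>z\<in>UNIV. P x' z)) /
       ((\<Sum>z\<in>UNIV. \<Sum>x'\<in>{x'. \<forall>l\<in>S. x' l = x l}. P x' z) * (\<Sum>x'\<in>UNIV. P x' z)))) =
    (\<Sum>x\<in>UNIV. \<Sum>z\<in>UNIV. P x z * log 2 ((p * (?wS x * m S x z) * p) / (p * ?wS x * (p * qZ z))))"
    unfolding agree agree_sum PZ by (simp only:)
  also have "\<dots> = (\<Sum>x\<in>UNIV. \<Sum>z\<in>UNIV. p * (?w x * W x z * log 2 (m S x z / qZ z)))"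
  proof (intro sum.cong refl)
    fix x z
    show "P x z * log 2 ((p * (?wS x * m S x z) * p) / (p * ?wS x * (p * qZ z))) =
        p * (?w x * W x z * log 2 (m S x z / qZ z))"
    proof (cases "p = 0 \<or> ?w x = 0")
      case False
      then have "?wS x \<noteq> 0" by auto
      then have "(p * (?wS x * m S x z) * p) / (p * ?wS x * (p * qZ z)) = m S x z / qZ z"
        using False by (simp add: divide_simps)
      then show ?thesis by (simp only: P_def mult.assoc)
    next
      case True
      then show ?thesis unfolding P_def by (auto simp only: mult_zero_left mult_zero_right)
    qed
  qed
  also have "\<dots> = p * info W qZ a $ S"
    unfolding info_eq_log by (simp only: sum_distrib_left)
  finally show ?thesis .
qed

end

lemma cond_MI_eq:
  assumes W: "channel W" and a: "\<And>t. t \<in> TT \<Longrightarrow> a t \<in> feasible W qZ"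
    and q: "\<And>l t. t \<in> TT \<Longrightarrow> qXT l t = bern (a t) l"
  shows "cond_MI W TT pT qXT S = (\<Sum>t\<in>TT. pT t * info W qZ (a t) $ S)"
  unfolding cond_MI_def Let_def
proof (rule sum.cong)
  fix t assume t: "t \<in> TT"
  interpret letter W qZ "a t" using W a[OF t] by unfold_locales
  show "(\<Sum>x\<in>UNIV. \<Sum>z\<in>UNIV. pT t * (\<Prod>l\<in>UNIV. qXT l t (x l)) * W x z * log 2
      (((\<Sum>x'\<in>{x'. \<forall>l\<in>S. x' l = x l}. pT t * (\<Prod>l\<in>UNIV. qXT l t (x' l)) * W x' z) *
        (\<Sum>x'\<in>UNIV. \<Sum>z\<in>UNIV. pT t * (\<Prod>l\<in>UNIV. qXT l t (x' l)) * W x' z)) /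
       ((\<Sum>z\<in>UNIV. \<Sum>x'\<in>{x'. \<forall>l\<in>S. x' l = x l}. pT t * (\<Prod>l\<in>UNIV. qXT l t (x' l)) * W x' z) *
        (\<Sum>x'\<in>UNIV. pT t * (\<Prod>l\<in>UNIV. qXT l t (x' l)) * W x' z)))) =
    pT t * info W qZ (a t) $ S"
    unfolding q[OF t] by (rule cond_MI_summand)
qed simp

lemma out_dist_eq: "out_dist W q z = expect bits q (\<lambda>x. W x z)"
  by (simp add: out_dist_def expect_def mult.commute)

lemma bern_bias:
  assumes "\<And>l. pmf_on UNIV (q l)"
  shows "q l = bern (\<chi> l. q l True) l"
proof -
  have "q l True + q l False = 1" using assms[of l] by (simp add: pmf_on_def UNIV_bool)
  then show ?thesis by (auto simp: bern_def fun_eq_iff)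
qed

lemma feasible_bias:
  assumes q: "\<And>l. pmf_on UNIV (q l)" and out: "\<And>z. qZ z = out_dist W q z"
  shows "(\<chi> l. q l True) \<in> feasible W qZ"
proof -
  have "0 \<le> q l True \<and> q l True \<le> 1" for l
  proof -
    have "0 \<le> q l True" "0 \<le> q l False" "q l True + q l False = 1"
      using q[of l] by (auto simp: pmf_on_def UNIV_bool)
    then show ?thesis by linarith
  qed
  moreover have "bern (\<chi> l. q l True) = q" 
    by (rule ext) (rule bern_bias[of q, OF q, symmetric])
  ultimately show ?thesis by (simp add: feasible_def out out_dist_eq)
qed

text \<open>The vectors lie in a hyperplane of a space of dimension \<open>2 ^ CARD('l)\<close>, so
  that many points suffice in Caratheodory's theorem.\<close>

lemma aff_dim_info:
  fixes W :: "('l::finite \<Rightarrow> bool) \<Rightarrow> 'z::finite \<Rightarrow> real"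
  assumes W: "channel W"
  shows "aff_dim (info W qZ ` feasible W qZ) + 1 \<le> 2 ^ CARD('l)"
proof -
  have "aff_dim (info W qZ ` feasible W qZ) \<le> aff_dim {v :: real ^ ('l set). axis {} 1 \<bullet> v = 0}"
  proof (intro aff_dim_subset subsetI)
    fix v assume "v \<in> info W qZ ` feasible W qZ"
    then obtain a where "a \<in> feasible W qZ" "v = info W qZ a" by auto
    then show "v \<in> {v. axis {} 1 \<bullet> v = 0}"
      using letter.info_empty[OF letter.intro[OF W]] by (simp add: inner_axis')
  qed
  also have "\<dots> = DIM(real ^ ('l set)) - 1"
    by (rule aff_dim_hyperplane) (simp add: axis_eq_0_iff)
  finally show ?thesis by (simp add: card_UNIV_set)
qed

theorem region'_eq_hull_region:
  fixes W :: "('l::finite \<Rightarrow> bool) \<Rightarrow> 'z::finite \<Rightarrow> real"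
  assumes W: "channel W"
  shows "region' W qZ = hull_region W qZ"
proof (intro equalityI subsetI)
  let ?T = "Tset TYPE('l) TYPE('z)"
  have finT: "finite ?T" by (simp add: Tset_def)
  {
    fix R assume "R \<in> region' W qZ"
    then obtain pT qXT where p: "pmf_on ?T pT" and
      qXT: "\<forall>l. \<forall>t\<in>?T. pmf_on UNIV (qXT l t)" "\<forall>t\<in>?T. \<forall>z. qZ z = out_dist W (\<lambda>l. qXT l t) z"
        "\<forall>S. cond_MI W ?T pT qXT S \<le> (\<Sum>l\<in>S. R $ l)"
      unfolding region'_def UN_iff mem_Collect_eq by (elim bexE CollectE conjE)
    then have q: "\<And>l t. t \<in> ?T \<Longrightarrow> pmf_on UNIV (qXT l t)"
      and out: "\<And>t z. t \<in> ?T \<Longrightarrow> qZ z = out_dist W (\<lambda>l. qXT l t) z"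
      and R: "\<And>S. cond_MI W ?T pT qXT S \<le> (\<Sum>l\<in>S. R $ l)"
      by (simp_all only:)
    define a where "a t = (\<chi> l. qXT l t True)" for t
    have a: "a t \<in> feasible W qZ" if "t \<in> ?T" for t
      unfolding a_def using q[OF that] out[OF that] by (rule feasible_bias)
    have qa: "qXT l t = bern (a t) l" if "t \<in> ?T" for l t
      unfolding a_def using q[OF that] by (rule bern_bias)
    have "(\<Sum>t\<in>?T. pT t *\<^sub>R info W qZ (a t)) \<in> convex hull (info W qZ ` feasible W qZ)"
      using p a by (intro convex_sum[OF finT convex_convex_hull]) (auto simp: pmf_on_def intro!: hull_inc)
    moreover have "(\<Sum>t\<in>?T. pT t *\<^sub>R info W qZ (a t)) $ S \<le> (\<Sum>l\<in>S. R $ l)" for S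
      using R[of S] cond_MI_eq[where TT = ?T and a = a and qXT = qXT and pT = pT and S = S, OF W a qa] by simp
    ultimately show "R \<in> hull_region W qZ" unfolding hull_region_def by blast
  next
    fix R assume "R \<in> hull_region W qZ"
    then obtain v where v: "v \<in> convex hull (info W qZ ` feasible W qZ)"
      and R: "\<And>S. v $ S \<le> (\<Sum>l\<in>S. R $ l)"
      unfolding hull_region_def by blast
    obtain V u where V: "finite V" "V \<subseteq> info W qZ ` feasible W qZ"
        "int (card V) \<le> aff_dim (info W qZ ` feasible W qZ) + 1"
      and u: "\<And>x. x \<in> V \<Longrightarrow> 0 \<le> u x" "sum u V = 1" and v_eq: "(\<Sum>x\<in>V. u x *\<^sub>R x) = v"
      using v unfolding convex_hull_caratheodory_aff_dim by auto
    have "int (card V) \<le> int (2 ^ CARD('l))" using order_trans[OF V(3) aff_dim_info[OF W]]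
      by (simp only: of_nat_power of_nat_numeral)
    then have "card V \<le> 2 ^ CARD('l)" by (simp only: of_nat_le_iff)
    moreover have "0 < CARD('z)" by simp
    \<comment> \<open>\<open>CARD('z) \<ge> 1\<close> makes up for the subtracted 1.\<close>
    ultimately have "card V \<le> CARD('z) + 2 ^ CARD('l) - 1" by linarith
    then have sub: "{1..card V} \<subseteq> ?T" by (auto simp: Tset_def)
    have "\<forall>x\<in>V. \<exists>a. a \<in> feasible W qZ \<and> info W qZ a = x" using V(2) by blast
    then obtain b where b: "\<And>x. x \<in> V \<Longrightarrow> b x \<in> feasible W qZ" "\<And>x. x \<in> V \<Longrightarrow> info W qZ (b x) = x"
      by metis
    \<comment> \<open>The output constraint binds at every time-sharing index, also at those of
      probability 0; these receive the bias \<open>a0\<close>.\<close>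
    obtain a0 where a0: "a0 \<in> feasible W qZ" using u(2) V(2) by (cases "V = {}") auto
    obtain h where h: "bij_betw h {1..card V} V"
      using ex_bij_betw_nat_finite_1[OF V(1)] by blast
    then have hV: "h t \<in> V" if "t \<in> {1..card V}" for t using that by (auto simp: bij_betw_def)
    define pT where "pT t = (if t \<in> {1..card V} then u (h t) else 0)" for t
    define a where "a t = (if t \<in> {1..card V} then b (h t) else a0)" for t
    have a: "a t \<in> feasible W qZ" for t using b(1) a0 hV by (simp add: a_def)
    have pm: "pmfs bits (bern (a t))" for t
      using letter.pm[OF letter.intro[OF W a]] .
    have sumT: "(\<Sum>t\<in>?T. pT t * F t) = (\<Sum>x\<in>V. u x * G x)"
      if "\<And>t. t \<in> {1..card V} \<Longrightarrow> F t = G (h t)" for F :: "nat \<Rightarrow> real" and G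
    proof -
      have "(\<Sum>t\<in>?T. pT t * F t) = (\<Sum>t\<in>{1..card V}. pT t * F t)"
        by (rule sum.mono_neutral_right[OF finT sub]) (auto simp: pT_def)
      also have "\<dots> = (\<Sum>t\<in>{1..card V}. u (h t) * G (h t))"
        using that by (intro sum.cong) (auto simp: pT_def)
      also have "\<dots> = (\<Sum>x\<in>V. u x * G x)"
        by (rule sum.reindex_bij_betw[OF h])
      finally show ?thesis .
    qed
    have "pmf_on ?T pT"
      unfolding pmf_on_def using sumT[of "\<lambda>_. 1" "\<lambda>_. 1"] u hV by (auto simp: pT_def)
    moreover have "\<forall>l. \<forall>t\<in>?T. pmf_on UNIV (bern (a t) l)"
      using pm by (auto simp: pmfs_def)
    moreover have "\<forall>t\<in>?T. \<forall>z. qZ z = out_dist W (\<lambda>l. bern (a t) l) z"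
      using a by (auto simp: feasible_def out_dist_eq)
    moreover have "cond_MI W ?T pT (\<lambda>l t. bern (a t) l) S \<le> (\<Sum>l\<in>S. R $ l)" for S
    proof -
      have "cond_MI W ?T pT (\<lambda>l t. bern (a t) l) S = (\<Sum>t\<in>?T. pT t * info W qZ (a t) $ S)"
        by (rule cond_MI_eq[OF W a]) simp
      also have "\<dots> = (\<Sum>x\<in>V. u x * x $ S)"
        by (rule sumT) (simp add: a_def b hV)
      also have "\<dots> = v $ S" by (simp add: v_eq[symmetric])
      finally show ?thesis using R by simp
    qed
    ultimately show "R \<in> region' W qZ"
      unfolding region'_def by (intro UN_I[of pT] UN_I[of "\<lambda>l t. bern (a t) l"]) auto
  }
qed

section \<open>Compactness and the theorem\<close>

text \<open>Only 0 is critical; near it \<open>\<bar>xlnx u\<bar> \<le> 2 * sqrt u\<close>, from the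
  logarithm bound at \<open>1 / sqrt u\<close>.\<close>

lemma continuous_on_xlnx: "continuous_on {0..} xlnx"
proof -
  have "(xlnx \<longlongrightarrow> xlnx 0) (at 0 within {0..})"
  proof (rule tendsto_eq_rhs[OF Lim_null_comparison])
    have "\<bar>xlnx u\<bar> \<le> 2 * sqrt u" if "0 \<le> u" "u \<le> 1" for u
    proof (cases "u = 0")
      case False
      then have u: "0 < u" using that by simp
      have "ln (1 / sqrt u) \<le> 1 / sqrt u" using ln_le_minus_one[of "1 / sqrt u"] u by simp
      then have "- ln u \<le> 2 / sqrt u" using u by (simp add: ln_div ln_sqrt)
      then have "u * - ln u \<le> u * (2 / sqrt u)" using u by (intro mult_left_mono) auto
      also have "\<dots> = 2 * (u / sqrt u)" by simp
      also have "\<dots> = 2 * sqrt u" using u by (simp only: real_div_sqrt less_imp_le)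
      finally show ?thesis using u that by (simp add: xlnx_def abs_mult abs_of_nonpos)
    qed simp
    moreover have "\<forall>\<^sub>F u in at 0 within {0..}. 0 \<le> u \<and> u \<le> (1::real)"
      unfolding eventually_at by (rule exI[of _ 1]) (auto simp: dist_real_def)
    ultimately show "\<forall>\<^sub>F u in at 0 within {0..}. norm (xlnx u) \<le> 2 * sqrt u"
      by (auto elim!: eventually_mono)
    show "((\<lambda>u. 2 * sqrt u) \<longlongrightarrow> 0) (at 0 within {0..})"
      by (rule tendsto_eq_intros tendsto_ident_at | simp)+
  qed simp
  moreover have "(xlnx \<longlongrightarrow> xlnx u) (at u within {0..})" if "0 < u" for u
    unfolding xlnx_def using that by (auto intro!: tendsto_intros)
  ultimately show ?thesis
    unfolding continuous_on_def by (metis atLeast_iff less_eq_real_def)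
qed

section \<open>Compactness of the set of feasible biases\<close>

definition cube :: "(real ^ 'l) set" where
  "cube = {a. \<forall>l. 0 \<le> a $ l \<and> a $ l \<le> 1}"

lemma compact_cube: "compact (cube :: (real ^ 'l::finite) set)"
proof -
  have "(cube :: (real ^ 'l) set) = cbox (\<chi> l. 0) (\<chi> l. 1)" by (auto simp: cube_def mem_box_cart)
  then show ?thesis by (metis compact_cbox)
qed

lemma continuous_on_bern [continuous_intros]:
  "continuous_on X f \<Longrightarrow> continuous_on X (\<lambda>a. bern (f a) l b)"
  by (cases b) (auto simp: bern_def intro!: continuous_intros)

lemma continuous_on_expect_bern:
  fixes F :: "real ^ 'l::finite \<Rightarrow> ('l \<Rightarrow> bool) \<Rightarrow> real"
  shows "(\<And>x. continuous_on X (\<lambda>a. F a x)) \<Longrightarrow> continuous_on X (\<lambda>a. expect bits (bern a) (F a))"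
  unfolding expect_def by (intro continuous_intros) auto

lemma continuous_on_info:
  assumes W: "channel W"
  shows "continuous_on cube (info W qZ)"
proof -
  have "continuous_on cube (\<lambda>a. xlnx (marg bits (bern a) W S x z))" for S x z
  proof (rule continuous_on_compose2[OF continuous_on_xlnx])
    show "continuous_on cube (\<lambda>a. marg bits (bern a) W S x z)"
      unfolding marg_def by (intro continuous_on_expect_bern continuous_intros)
    show "(\<lambda>a. marg bits (bern a) W S x z) ` cube \<subseteq> {0..}"
      by (auto simp: cube_def intro!: marg_nonneg pmfs_bern channel_nonneg[OF W])
  qed
  then show ?thesis
    unfolding info_def neg_entropy_def
    by (intro continuous_on_vec_lambda continuous_intros continuous_on_expect_bern) auto
qed

lemma feasible_subset_cube: "feasible W qZ \<subseteq> cube"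
  by (auto simp: feasible_def cube_def)

lemma compact_feasible: "compact (feasible W qZ)"
proof -
  have "feasible W qZ = cube \<inter> (\<Inter>z. {a. expect bits (bern a) (\<lambda>x. W x z) = qZ z})"
    by (auto simp: feasible_def cube_def)
  moreover have "closed {a. expect bits (bern a) (\<lambda>x. W x z) = qZ z}" for z
    by (intro closed_Collect_eq continuous_on_expect_bern continuous_intros)
  ultimately show ?thesis by (metis (no_types, lifting) closed_INT compact_Int_closed compact_cube)
qed

lemma compact_info_hull:
  assumes "channel W"
  shows "compact (convex hull (info W qZ ` feasible W qZ))"
  by (intro compact_convex_hull compact_continuous_image compact_feasible
      continuous_on_subset[OF continuous_on_info[OF assms] feasible_subset_cube])

text \<open>The region is the preimage, under the linear map of subset sums, of a compact hull plus
  a closed orthant.\<close>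

lemma closed_hull_region:
  fixes W :: "('l::finite \<Rightarrow> bool) \<Rightarrow> 'z::finite \<Rightarrow> real"
  assumes W: "channel W"
  shows "closed (hull_region W qZ)"
proof -
  let ?C = "convex hull (info W qZ ` feasible W qZ)"
  let ?O = "{w :: real ^ ('l set). \<forall>S. 0 \<le> w $ S}"
  let ?f = "\<lambda>R :: real ^ 'l. (\<chi> S. \<Sum>l\<in>S. R $ l)"
  have eq: "hull_region W qZ = ?f -` (\<Union>x\<in>?C. \<Union>y\<in>?O. {x + y})"
  proof (intro set_eqI iffI)
    fix R assume "R \<in> hull_region W qZ"
    then obtain v where "v \<in> ?C" "\<And>S. v $ S \<le> (\<Sum>l\<in>S. R $ l)"
      unfolding hull_region_def by blast
    then show "R \<in> ?f -` (\<Union>x\<in>?C. \<Union>y\<in>?O. {x + y})"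
      by (auto intro!: bexI[of _ v] exI[of _ "?f R - v"])
  next
    fix R assume "R \<in> ?f -` (\<Union>x\<in>?C. \<Union>y\<in>?O. {x + y})"
    then obtain v w where vw: "v \<in> ?C" "\<And>S. 0 \<le> w $ S" "?f R = v + w" by auto
    have "v $ S \<le> (\<Sum>l\<in>S. R $ l)" for S
      using arg_cong[OF vw(3), of "\<lambda>u. u $ S"] vw(2)[of S] by simp
    then show "R \<in> hull_region W qZ" unfolding hull_region_def using vw(1) by blast
  qed
  have "closed ?O"
    by (intro closed_Collect_all closed_Collect_le continuous_intros)
  then have "closed (\<Union>x\<in>?C. \<Union>y\<in>?O. {x + y})"
    by (intro compact_closed_sums compact_info_hull W)
  moreover have "continuous_on UNIV ?f"
    by (intro continuous_on_vec_lambda continuous_intros)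
  ultimately show ?thesis unfolding eq by (rule closed_vimage)
qed

text \<open>On the compact set of biases whose \<open>info\<close> stays \<open>\<delta>\<close>
  away from the feasible image, the output error is continuous and positive. Its minimum there
  serves as \<open>\<epsilon>\<close>.\<close>

lemma info_near_feasible:
  fixes W :: "('l::finite \<Rightarrow> bool) \<Rightarrow> 'z::finite \<Rightarrow> real"
  assumes W: "channel W" and \<delta>: "0 < \<delta>" and ne: "feasible W qZ \<noteq> {}"
  obtains \<epsilon> where "0 < \<epsilon>"
    "\<And>a. a \<in> cube \<Longrightarrow> (\<Sum>z\<in>UNIV. \<bar>expect bits (bern a) (\<lambda>x. W x z) - qZ z\<bar>) < \<epsilon> \<Longrightarrow>
      \<exists>a'\<in>feasible W qZ. dist (info W qZ a) (info W qZ a') < \<delta>"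
proof -
  define g where "g a = (\<Sum>z\<in>UNIV. \<bar>expect bits (bern a) (\<lambda>x. W x z) - qZ z\<bar>)" for a :: "real ^ 'l"
  let ?F = "info W qZ ` feasible W qZ"
  define B where "B = {a \<in> cube. \<delta> \<le> infdist (info W qZ a) ?F}"
  have g: "continuous_on X g" for X
    unfolding g_def by (intro continuous_intros continuous_on_expect_bern)
  have "closed B"
    unfolding B_def
    by (intro continuous_on_closed_Collect_le compact_imp_closed[OF compact_cube] continuous_intros
        continuous_on_info W)
  moreover have "B \<subseteq> cube" by (auto simp: B_def)
  ultimately have B: "compact B" using compact_Int_closed[OF compact_cube, of B] by (simp add: Int_absorb1)
  have near: "\<exists>a'\<in>feasible W qZ. dist (info W qZ a) (info W qZ a') < \<delta>" if "a \<in> cube" "a \<notin> B" for a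
  proof -
    have "infdist (info W qZ a) ?F < \<delta>" using that by (auto simp: B_def)
    moreover have "\<delta> \<le> infdist (info W qZ a) ?F" if "\<forall>a'\<in>feasible W qZ. \<delta> \<le> dist (info W qZ a) (info W qZ a')"
      using ne that unfolding infdist_def by (auto intro!: cINF_greatest)
    ultimately show ?thesis by (meson not_le)
  qed
  have pos: "0 < g a" if "a \<in> B" for a
  proof (rule ccontr)
    assume "\<not> 0 < g a"
    moreover have "0 \<le> g a" unfolding g_def by (intro sum_nonneg) auto
    ultimately have "g a = 0" by simp
    then have "a \<in> feasible W qZ"
      using that unfolding g_def by (subst (asm) sum_nonneg_eq_0_iff) (auto simp: feasible_def B_def cube_def)
    then have "infdist (info W qZ a) ?F = 0" by (intro infdist_zero) auto
    then show False using that \<delta> by (simp add: B_def)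
  qed
  show thesis
  proof (cases "B = {}")
    case True
    \<comment> \<open>No bias is far away, so any positive \<open>\<epsilon>\<close> will
      do.\<close>
    then show ?thesis using near by (intro that[of 1]) auto
  next
    case False
    then obtain b where b: "b \<in> B" "\<And>a. a \<in> B \<Longrightarrow> g b \<le> g a"
      using continuous_attains_inf[OF B False g] by blast
    show ?thesis
    proof (rule that[OF pos[OF b(1)]])
      fix a assume "a \<in> cube" "(\<Sum>z\<in>UNIV. \<bar>expect bits (bern a) (\<lambda>x. W x z) - qZ z\<bar>) < g b"
      then show "\<exists>a'\<in>feasible W qZ. dist (info W qZ a) (info W qZ a') < \<delta>"
        using near[of a] b(2)[of a] by (force simp: g_def)
    qed
  qed
qed

text \<open>One \<open>\<delta>\<close> pays for moving the letter biases to feasible ones, the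
  other for the entropy error bounded in \<open>small\<close>.\<close>

lemma code_in_hull_region:
  fixes W :: "('l::finite \<Rightarrow> bool) \<Rightarrow> 'z::finite \<Rightarrow> real"
  assumes W: "channel W" and a0: "a0 \<in> feasible W qZ" and N: "0 < N" and \<delta>: "0 < \<delta>"
    and near: "\<And>a. a \<in> cube \<Longrightarrow> (\<Sum>z\<in>UNIV. \<bar>expect bits (bern a) (\<lambda>x. W x z) - qZ z\<bar>) < \<epsilon> \<Longrightarrow>
      \<exists>a'\<in>feasible W qZ. dist (info W qZ a) (info W qZ a') < \<delta>"
    and V: "V = var_dist_N N (induced_dist W R N f) (\<lambda>zs. \<Prod>i<N. qZ (zs i))" "V < \<epsilon>" "V < 1"
    and small: "(V * (real N * ln (real CARD('z))) + 1) / (real N * ln 2) \<le> \<delta>"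
  shows "(\<chi> l. R $ l + 2 * \<delta>) \<in> hull_region W qZ"
proof -
  interpret L: letter W qZ a0 using W a0 by unfold_locales
  let ?I = "\<lambda>l. {1..msg_size N (R $ l)}"
  \<comment> \<open>An empty message set, as a negative rate may cause, makes the induced
    distribution identically 0, at variation distance 1 from the target.\<close>
  have M: "1 \<le> msg_size N (R $ l)" for l
  proof (rule ccontr)
    assume "\<not> 1 \<le> msg_size N (R $ l)"
    then have "Pi\<^sub>E UNIV ?I = {}" unfolding PiE_eq_empty_iff by (intro bexI[of _ l]) auto
    then have "V = (\<Sum>zs\<in>words N. \<bar>\<Prod>i<N. qZ (zs i)\<bar>)"
      by (simp add: V(1) var_dist_N_def induced_dist_def)
    also have "\<dots> = (\<Sum>zs\<in>words N. \<Prod>i<N. qZ (zs i))"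
      by (intro sum.cong refl abs_of_nonneg prod_nonneg) (simp add: L.qZ_nonneg)
    also have "\<dots> = 1" by (subst sum_words_prod) (simp add: L.qZ_sum)
    finally show False using V(3) by simp
  qed
  interpret code W ?I f N
    using W M by unfold_locales auto
  have V_eq: "V = (\<Sum>zs\<in>words N. \<bar>p zs - (\<Prod>i<N. qZ (zs i))\<bar>)"
    by (simp only: V(1) var_dist_N_def induced_dist_eq)
  have "\<forall>i<N. \<exists>a'\<in>feasible W qZ. dist (info W qZ (bias i)) (info W qZ a') < \<delta>"
  proof (intro allI impI near)
    fix i assume "i < N"
    then show "(\<Sum>z\<in>UNIV. \<bar>expect bits (bern (bias i)) (\<lambda>x. W x z) - qZ z\<bar>) < \<epsilon>"
      using letter_output_close[OF L.qZ_sum] V(2) unfolding V_eq by force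
  qed (auto simp only: cube_def mem_Collect_eq bias_bounds)
  then obtain c where c: "\<And>i. i < N \<Longrightarrow> c i \<in> feasible W qZ"
    "\<And>i. i < N \<Longrightarrow> dist (info W qZ (bias i)) (info W qZ (c i)) < \<delta>"
    by metis
  define v where "v = (\<Sum>i<N. (1 / real N) *\<^sub>R info W qZ (c i))"
  have v: "v \<in> convex hull (info W qZ ` feasible W qZ)"
    unfolding v_def using N c(1)
    by (intro convex_sum[OF _ convex_convex_hull]) (auto intro!: hull_inc)
  have v_nth: "v $ S = (\<Sum>i<N. info W qZ (c i) $ S) / real N" for S
    by (simp add: v_def sum_divide_distrib)
  have le: "v $ S \<le> (\<Sum>l\<in>S. R $ l) + 2 * \<delta>" for S
  proof -
    have "info W qZ (c i) $ S \<le> info W qZ (bias i) $ S + \<delta>" if "i < N" for i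
      using c(2)[OF that] dist_vec_nth_le[of "info W qZ (bias i)" S "info W qZ (c i)"]
      by (simp add: dist_real_def)
    then have "(\<Sum>i<N. info W qZ (c i) $ S) \<le> (\<Sum>i<N. info W qZ (bias i) $ S + \<delta>)"
      by (intro sum_mono) auto
    also have "\<dots> = (\<Sum>i<N. neg_entropy W (bias i) S - (\<Sum>z\<in>UNIV. xlnx (qZ z))) / ln 2 + real N * \<delta>"
      by (simp add: info_def sum.distrib sum_divide_distrib)
    also have "\<dots> \<le> (ln (\<Prod>l\<in>S. real (card (?I l))) + V * (real N * ln (real CARD('z))) + 1) / ln 2 + real N * \<delta>"
      using sum_neg_entropy_le[OF L.qZ_sum L.qZ_nonneg, of S] unfolding V_eq
      by (intro add_right_mono divide_right_mono) auto
    also have "ln (\<Prod>l\<in>S. real (card (?I l))) \<le> real N * (\<Sum>l\<in>S. R $ l) * ln 2"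
    proof -
      have "ln (\<Prod>l\<in>S. real (card (?I l))) = (\<Sum>l\<in>S. ln (real (msg_size N (R $ l))))"
        using M by (subst ln_prod) (auto simp: not_less_eq_eq Suc_le_eq)
      also have "\<dots> \<le> (\<Sum>l\<in>S. real N * R $ l * ln 2)"
      proof (rule sum_mono)
        fix l
        have "real (msg_size N (R $ l)) \<le> 2 powr (real N * R $ l)" by (simp add: msg_size_def)
        then have "ln (real (msg_size N (R $ l))) \<le> ln (2 powr (real N * R $ l))"
          using M[of l] by (subst ln_le_cancel_iff) auto
        then show "ln (real (msg_size N (R $ l))) \<le> real N * R $ l * ln 2" by (simp add: ln_powr)
      qed
      finally show ?thesis by (simp add: sum_distrib_left sum_distrib_right)
    qed
    finally have "(\<Sum>i<N. info W qZ (c i) $ S) \<le>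
        (real N * (\<Sum>l\<in>S. R $ l) * ln 2 + V * (real N * ln (real CARD('z))) + 1) / ln 2 + real N * \<delta>"
      by (simp add: divide_right_mono)
    then have "v $ S \<le> ((real N * (\<Sum>l\<in>S. R $ l) * ln 2 + V * (real N * ln (real CARD('z))) + 1) / ln 2 + real N * \<delta>) / real N"
      unfolding v_nth by (intro divide_right_mono) auto
    also have "\<dots> = (\<Sum>l\<in>S. R $ l) + (V * (real N * ln (real CARD('z))) + 1) / (real N * ln 2) + \<delta>"
      using N by (simp add: add_divide_distrib mult.commute)
    finally show ?thesis using small by linarith
  qed
  have "v $ S \<le> (\<Sum>l\<in>S. (\<chi> l. R $ l + 2 * \<delta>) $ l)" for S
  \<comment> \<open>For \<open>S = {}\<close> the slack is an empty sum, so \<open>info\<close> must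
    vanish exactly there; for other \<open>S\<close> the slack is at least
    \<open>2 * \<delta>\<close>.\<close>
  proof (cases "S = {}")
    case True
    then show ?thesis
      using letter.info_empty[OF letter.intro[OF W c(1)]] by (simp add: v_nth)
  next
    case False
    then have "1 \<le> real (card S)" by (simp add: Suc_le_eq card_gt_0_iff)
    then have "2 * \<delta> \<le> real (card S) * (2 * \<delta>)" using \<delta> by (simp add: mult_le_cancel_right1)
    then show ?thesis using le[of S] by (simp add: sum.distrib)
  qed
  then show ?thesis using v unfolding hull_region_def by blast
qed

section \<open>The two inclusions\<close>

lemma translate_tendsto:
  fixes R :: "real ^ 'l::finite"
  shows "(\<lambda>n. \<chi> l. R $ l + c / real (Suc n)) \<longlonglongrightarrow> R"
proof (rule vec_tendstoI)
  fix l
  show "(\<lambda>n. (\<chi> l. R $ l + c / real (Suc n)) $ l) \<longlonglongrightarrow> R $ l"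
    using tendsto_add[OF tendsto_const[of "R $ l"] tendsto_mult_right_zero[OF LIMSEQ_inverse_real_of_nat, of c]]
    by (simp add: divide_inverse)
qed

text \<open>A sufficiently long good code puts each slightly raised tuple into the region;
  closedness removes the shift.\<close>

theorem achievable_in_hull_region:
  fixes W :: "('l::finite \<Rightarrow> bool) \<Rightarrow> 'z::finite \<Rightarrow> real"
  assumes W: "channel W" and a0: "a0 \<in> feasible W qZ" and R: "achievable W qZ R"
  shows "R \<in> hull_region W qZ"
proof -
  have approx: "(\<chi> l. R $ l + 2 * \<delta>) \<in> hull_region W qZ" if \<delta>: "0 < \<delta>" for \<delta>
  proof -
    obtain f where f: "(\<lambda>N. var_dist_N N (induced_dist W R N (f N)) (\<lambda>zs. \<Prod>i<N. qZ (zs i))) \<longlonglongrightarrow> 0"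
      using R unfolding achievable_def by blast
    define V where "V N = var_dist_N N (induced_dist W R N (f N)) (\<lambda>zs. \<Prod>i<N. qZ (zs i))" for N
    have V: "V \<longlonglongrightarrow> 0" using f by (simp add: V_def[abs_def])
    obtain \<epsilon> where \<epsilon>: "0 < \<epsilon>"
      "\<And>a. a \<in> cube \<Longrightarrow> (\<Sum>z\<in>UNIV. \<bar>expect bits (bern a) (\<lambda>x. W x z) - qZ z\<bar>) < \<epsilon> \<Longrightarrow>
        \<exists>a'\<in>feasible W qZ. dist (info W qZ a) (info W qZ a') < \<delta>"
      using info_near_feasible[OF W \<delta>] a0 by blast
    have "(\<lambda>N. V N * (ln (real CARD('z)) / ln 2) + inverse (real N) * (1 / ln 2)) \<longlonglongrightarrow>
        0 * (ln (real CARD('z)) / ln 2) + 0 * (1 / ln 2)"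
      by (intro tendsto_intros V lim_inverse_n)
    then have "\<forall>\<^sub>F N in sequentially. V N * (ln (real CARD('z)) / ln 2) + inverse (real N) * (1 / ln 2) < \<delta>"
      using \<delta> by (auto elim!: order_tendstoD(2))
    moreover have "\<forall>\<^sub>F N in sequentially. V N < min \<epsilon> 1"
      using V \<epsilon>(1) by (intro order_tendstoD(2)[OF V]) simp
    moreover have "\<forall>\<^sub>F N in sequentially. 0 < (N::nat)"
      by (rule eventually_gt_at_top)
    ultimately have "\<forall>\<^sub>F N in sequentially.
        V N * (ln (real CARD('z)) / ln 2) + inverse (real N) * (1 / ln 2) < \<delta> \<and> V N < min \<epsilon> 1 \<and> 0 < N"
      by (intro eventually_conj)
    from eventually_happens[OF this] obtain N where N: "0 < N" "V N < \<epsilon>" "V N < 1"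
      "V N * (ln (real CARD('z)) / ln 2) + inverse (real N) * (1 / ln 2) < \<delta>"
      by auto
    moreover have "(V N * (real N * ln (real CARD('z))) + 1) / (real N * ln 2) =
        V N * (ln (real CARD('z)) / ln 2) + inverse (real N) * (1 / ln 2)"
      using N(1) by (simp add: field_simps)
    ultimately show ?thesis
      by (intro code_in_hull_region[OF W a0 N(1) \<delta> \<epsilon>(2) V_def]) auto
  qed
  have "(\<chi> l. R $ l + 2 / real (Suc n)) \<in> hull_region W qZ" for n
    using approx[of "1 / real (Suc n)"] by simp
  then show ?thesis
    using closed_sequentially[OF closed_hull_region[OF W] _ translate_tendsto[of R 2]] by blast
qed

text \<open>Raising every rate by \<open>1 / Suc n\<close> makes the constraints strict for all
  nonempty \<open>S\<close>.\<close>

theorem hull_region_in_closure: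
  fixes W :: "('l::finite \<Rightarrow> bool) \<Rightarrow> 'z::finite \<Rightarrow> real"
  assumes W: "channel W" and R: "R \<in> hull_region W qZ"
  shows "R \<in> closure {R. achievable W qZ R}"
proof -
  obtain v where v: "v \<in> convex hull (info W qZ ` feasible W qZ)" "\<And>S. v $ S \<le> (\<Sum>l\<in>S. R $ l)"
    using R unfolding hull_region_def by blast
  have "achievable W qZ (\<chi> l. R $ l + 1 / real (Suc n))" for n
  proof (rule achievable_if_above_hull[OF W v(1)])
    fix S :: "'l set" assume "S \<noteq> {}"
    then have "0 < (\<Sum>l\<in>S. 1 / real (Suc n))" by (intro sum_pos) auto
    then show "v $ S < (\<Sum>l\<in>S. (\<chi> l. R $ l + 1 / real (Suc n)) $ l)"
      using v(2)[of S] by (simp only: vec_lambda_beta sum.distrib)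
  qed
  then show ?thesis
    unfolding closure_sequential using translate_tendsto[of R 1]
    by (intro exI[of _ "\<lambda>n. \<chi> l. R $ l + 1 / real (Suc n)"]) simp
qed

theorem theorem4:
  fixes W :: "('l::finite \<Rightarrow> bool) \<Rightarrow> 'z::finite \<Rightarrow> real"
    and qX :: "'l \<Rightarrow> bool \<Rightarrow> real"
    and qZ :: "'z \<Rightarrow> real"
  assumes "channel W"
    and "\<forall>l. pmf_on UNIV (qX l)"
    and "\<forall>z. qZ z = out_dist W qX z"
  shows "resolvability_region W qZ = region' W qZ"
proof -
  \<comment> \<open>The given product input law shows that \<open>feasible\<close> is nonempty,
    which the converse relies on.\<close>
  have a0: "(\<chi> l. qX l True) \<in> feasible W qZ"
    using assms(2,3) by (intro feasible_bias) auto
  have "closure {R. achievable W qZ R} \<subseteq> hull_region W qZ"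
    using achievable_in_hull_region[OF assms(1) a0]
    by (intro closure_minimal closed_hull_region assms(1)) auto
  moreover have "hull_region W qZ \<subseteq> closure {R. achievable W qZ R}"
    using hull_region_in_closure[OF assms(1)] by blast
  ultimately show ?thesis
    unfolding resolvability_region_def region'_eq_hull_region[OF assms(1)] by (rule equalityI)
qed

end
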